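(* Let $V$ be a $d$-dimensional vector space over a field $F$, and let $A=[v_1,\dots,v_d]$, $B=[w_1,\dots,w_d]$ be a pair of apartments (for bases $v_1,\dots,v_d$ and $w_1,\dots,w_d$ of $V$). For subsets $I=\{i_1<\dots<i_k\}$ and $J=\{j_1<\dots<j_{d-k}\}$ of $\{1,\dots,d\}$ put $A_I=\langle v_{i_1},\dots,v_{i_k}\rangle$ and $B_J=\langle w_{j_1},\dots,w_{j_{d-k}}\rangle$, and let $\{1,\dots,d\}\setminus I=\{i_1'<\dots<i_{d-k}'\}$, $\{1,\dots,d\}\setminus J=\{j_1'<\dots<j_k'\}$. Then the coproduct $\Delta$ of $\mathrm{St}^2$ is given by $$\Delta(A\otimes B)=\sum_{I,J}(-1)^{\sigma_I}(-1)^{\tau_J}\,(A,B)_{I,J}\otimes(A,B)^{I,J}\ \in\ \bigoplus_{I,J}\mathrm{St}^2(A_I)\otimes\mathrm{St}^2(B_J),$$ where the sum is over all pairs of subsets $I,J$ with $V=A_I\oplus B_J$, and $$(A,B)_{I,J}=[v_{i_1},\dots,v_{i_k}]\otimes\bigl[A_I\cap\langle w_{j_1'},B_J\rangle,\dots,A_I\cap\langle w_{j_k'},B_J\rangle\bigr]\in\mathrm{St}^2(A_I),$$ $$(A,B)^{I,J}=\bigl[B_J\cap\langle v_{i_1'},A_I\rangle,\dots,B_J\cap\langle v_{i_{d-k}'},A_I\rangle\bigr]\otimes[w_{j_1},\dots,w_{j_{d-k}}]\in\mathrm{St}^2(B_J).$$ Here $\sigma_I\in\mathfrak S_d$ is the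 permutation sending $(1,\dots,d)$ to $(i_1,\dots,i_k,i_1',\dots,i_{d-k}')$, and $\tau_J\in\mathfrak S_d$ is the permutation sending $(1,\dots,d)$ to $(j_1',\dots,j_k',j_1,\dots,j_{d-k})$.
   Context: **Steinberg module.** For a $d$-dimensional vector space $V$ over $F$, $\mathrm{St}(V)=\widetilde H_{d-2}(\mathcal T_V,\mathbb Q)$ ($\mathcal T_V$ the Tits building), with $\mathrm{St}(V)=\mathbb Q$ if $d\le 1$. It is spanned by apartments $[v_1,\dots,v_d]$ ($v_1,\dots,v_d$ a basis of $V$), the class of the cycle $\sum_{\sigma\in\mathfrak S_d}(-1)^\sigma(0\subsetneq\langle v_{\sigma(1)}\rangle\subsetneq\langle v_{\sigma(1)},v_{\sigma(2)}\rangle\subsetneq\dots\subsetneq V)$ in $C_{d-2}(\mathcal T_V)$, the free $\mathbb Q$-vector space on complete flags; thus $\mathrm{St}(V)\subseteq C_{d-2}(\mathcal T_V)$. For lines $P_i=\langle v_i\rangle$ write $[P_1,\dots,P_d]=[v_1,\dots,v_d]$. Put $\mathrm{St}^2(V)=\mathrm{St}(V)\otimes_{\mathbb Q}\mathrm{St}(V)$ ($=\mathbb Q$ for $V=0$). **Identification with a subspace of the bar complex.** For $d=\dim V$ let $\mathrm B_d\mathrm{St}(V)$ be the $\mathbb Q$-vector space with basis $[v_1|\cdots|v_d]$ indexed by ordered decompositions $V=\langle v_1\rangle\oplus\dots\oplus\langle v_d\rangle$ into lines. The linear map $\beta_d:\mathrm B_d\mathrm{St}(V)\to C_{d-2}(\mathcal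 T_V)\otimes\mathrm{St}(V)$, $[v_1|\cdots|v_d]\mapsto(0\subsetneq\langle v_1\rangle\subsetneq\dots\subsetneq\langle v_1,\dots,v_d\rangle)\otimes[v_1,\dots,v_d]$, is an isomorphism. Let $s:\mathrm{St}^2(V)\hookrightarrow\mathrm B_d\mathrm{St}(V)$ be the restriction of $\beta_d^{-1}$ to $\mathrm{St}(V)\otimes\mathrm{St}(V)$ (its image is the top homology of the bar complex of $\mathrm{St}$). **Coproduct.** $\Delta:\mathrm{St}^2(V)\to\bigoplus_{V=V_1\oplus V_2}\mathrm{St}^2(V_1)\otimes\mathrm{St}^2(V_2)$ (sum over ordered pairs of subspaces with internal direct sum $V$) is defined, through the identifications $s$, as the map induced by the deconcatenation coproduct $\Delta[v_1|\cdots|v_d]=\sum_{k=0}^d[v_1|\cdots|v_k]\otimes[v_{k+1}|\cdots|v_d]$, where the $k$-th term lies in the summand $V_1=\langle v_1,\dots,v_k\rangle$, $V_2=\langle v_{k+1},\dots,v_d\rangle$. In the formula of the claim, each term lies in the summand $V_1=A_I$, $V_2=B_J$. *)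

theory Defs
  imports Complex_Main "HOL-Library.Poly_Mapping" "HOL-Combinatorics.Permutations"
begin

section \<open>Free rational vector spaces\<close>

text \<open>
  The free \<open>\<rat>\<close>-vector space on a type \<open>'a\<close> is \<open>'a \<Rightarrow>\<^sub>0 rat\<close>, with basis \<open>Poly_Mapping.single a 1\<close>.
  The tensor product of the free spaces on \<open>'a\<close> and \<open>'b\<close> is the free space on \<open>'a \<times> 'b\<close>; since we
  work over a field, the tensor product of subspaces \<open>X\<close>, \<open>Y\<close> is the span in it of the
  tensors \<open>x \<otimes> y\<close> with \<open>x \<in> X\<close>, \<open>y \<in> Y\<close>.
\<close>

definition fscale :: "rat \<Rightarrow> ('a \<Rightarrow>\<^sub>0 rat) \<Rightarrow> ('a \<Rightarrow>\<^sub>0 rat)" where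
  "fscale c x = Poly_Mapping.map ((*) c) x"

lemma lookup_fscale: "Poly_Mapping.lookup (fscale c x) a = c * Poly_Mapping.lookup x a"
  by (simp add: fscale_def Poly_Mapping.map.rep_eq when_def)

lemma vector_space_fscale: "vector_space fscale"
  by unfold_locales (auto intro!: poly_mapping_eqI simp: lookup_fscale lookup_add algebra_simps)

text \<open>The linear extension of a map defined on basis elements.\<close>

definition lin :: "('a \<Rightarrow> ('b \<Rightarrow>\<^sub>0 rat)) \<Rightarrow> ('a \<Rightarrow>\<^sub>0 rat) \<Rightarrow> ('b \<Rightarrow>\<^sub>0 rat)" where
  "lin f x = (\<Sum>a\<in>Poly_Mapping.keys x. fscale (Poly_Mapping.lookup x a) (f a))"

definition tensor :: "('a \<Rightarrow>\<^sub>0 rat) \<Rightarrow> ('b \<Rightarrow>\<^sub>0 rat) \<Rightarrow> ('a \<times> 'b \<Rightarrow>\<^sub>0 rat)" (infixr "\<otimes>" 75) where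
  "x \<otimes> y = (\<Sum>a\<in>Poly_Mapping.keys x. \<Sum>b\<in>Poly_Mapping.keys y. Poly_Mapping.single (a, b) (Poly_Mapping.lookup x a * Poly_Mapping.lookup y b))"

text \<open>The tensor product of two linear maps between free spaces.\<close>

definition tensor_map ::
  "(('a \<Rightarrow>\<^sub>0 rat) \<Rightarrow> ('c \<Rightarrow>\<^sub>0 rat)) \<Rightarrow> (('b \<Rightarrow>\<^sub>0 rat) \<Rightarrow> ('d \<Rightarrow>\<^sub>0 rat)) \<Rightarrow>
    ('a \<times> 'b \<Rightarrow>\<^sub>0 rat) \<Rightarrow> ('c \<times> 'd \<Rightarrow>\<^sub>0 rat)" where
  "tensor_map f g =
    lin (\<lambda>(a, b). f (Poly_Mapping.single a 1) \<otimes> g (Poly_Mapping.single b 1))"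

text \<open>
  A direct sum \<open>\<Oplus>\<^sub>i W\<close> of copies of a free space \<open>W\<close> is the tensor product of the free space on the
  indices with \<open>W\<close>; this is the inclusion of \<open>W\<close> as the summand of index \<open>i\<close>.
\<close>

definition in_summand :: "'i \<Rightarrow> ('a \<Rightarrow>\<^sub>0 rat) \<Rightarrow> ('i \<times> 'a \<Rightarrow>\<^sub>0 rat)" where
  "in_summand i x = Poly_Mapping.single i 1 \<otimes> x"


section \<open>The Steinberg module\<close>

definition omit :: "nat \<Rightarrow> 'a list \<Rightarrow> 'a list" where
  "omit i xs = take i xs @ drop (Suc i) xs"

text \<open>
  A simplex \<open>F\<^sub>1 \<subset> \<dots> \<subset> F\<^sub>m\<close> of the Tits building of \<open>U\<close> is represented by the list
  \<open>[0, F\<^sub>1, \<dots>, F\<^sub>m, U]\<close>; its vertices are the interior entries, so only these are omitted in the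
  boundary.  A chamber of the building of \<open>U\<close> thus has length \<open>dim U + 1\<close>. The
  list \<open>[0, U]\<close> is the empty simplex, so that for \<open>dim U = 2\<close> the boundary is the
  augmentation of reduced homology.
\<close>

definition boundary :: "('v set list \<Rightarrow>\<^sub>0 rat) \<Rightarrow> ('v set list \<Rightarrow>\<^sub>0 rat)" where
  "boundary =
    lin (\<lambda>fs. \<Sum>i\<in>{1..<length fs - 1}. Poly_Mapping.single (omit i fs) ((-1) ^ (i - 1)))"

locale steinberg = vector_space scale
  for scale :: "'f::field \<Rightarrow> 'v::ab_group_add \<Rightarrow> 'v"
begin

definition complete_flags :: "'v set \<Rightarrow> 'v set list set" where
  "complete_flags U = {fs. length fs = Suc (dim U) \<and> hd fs = {0} \<and> last fs = U \<and>
    (\<forall>X\<in>set fs. subspace X) \<and> sorted_wrt (\<subset>) fs}"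

text \<open>
  There are no simplices of dimension greater than \<open>dim U - 2\<close>, so the reduced homology in
  degree \<open>dim U - 2\<close> is the space of cycles. If \<open>dim U \<le> 1\<close> there is one complete flag, with zero
  boundary, and \<open>St U\<close> is one-dimensional.
\<close>

definition St :: "'v set \<Rightarrow> ('v set list \<Rightarrow>\<^sub>0 rat) set" where
  "St U = {x. Poly_Mapping.keys x \<subseteq> complete_flags U \<and> boundary x = 0}"

definition St2 :: "'v set \<Rightarrow> ('v set list \<times> 'v set list \<Rightarrow>\<^sub>0 rat) set" where
  "St2 U = module.span fscale {x \<otimes> y | x y. x \<in> St U \<and> y \<in> St U}"

definition flag_of_lines :: "'v set list \<Rightarrow> 'v set list" where
  "flag_of_lines Ps = map (\<lambda>k. span (\<Union>(set (take k Ps)))) [0..<Suc (length Ps)]"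

text \<open>The apartment \<open>[P\<^sub>1, \<dots>, P\<^sub>d]\<close> of a list of lines.\<close>

definition apartment :: "'v set list \<Rightarrow> ('v set list \<Rightarrow>\<^sub>0 rat)" where
  "apartment Ps = (\<Sum>\<sigma> | \<sigma> permutes {..<length Ps}.
    Poly_Mapping.single (flag_of_lines (permute_list \<sigma> Ps)) (of_int (sign \<sigma>)))"

definition vec_apartment :: "'v list \<Rightarrow> ('v set list \<Rightarrow>\<^sub>0 rat)" where
  "vec_apartment vs = apartment (map (\<lambda>v. span {v}) vs)"


section \<open>The bar complex and the coproduct\<close>

definition is_basis_list :: "'v set \<Rightarrow> 'v list \<Rightarrow> bool" where
  "is_basis_list U vs \<longleftrightarrow> distinct vs \<and> independent (set vs) \<and> span (set vs) = U"

definition line_decomps :: "'v set \<Rightarrow> 'v set list set" where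
  "line_decomps U = {map (\<lambda>v. span {v}) vs | vs. is_basis_list U vs}"

definition bar :: "'v set \<Rightarrow> ('v set list \<Rightarrow>\<^sub>0 rat) set" where
  "bar U = {y. Poly_Mapping.keys y \<subseteq> line_decomps U}"

definition beta :: "('v set list \<Rightarrow>\<^sub>0 rat) \<Rightarrow> ('v set list \<times> 'v set list \<Rightarrow>\<^sub>0 rat)" where
  "beta = lin (\<lambda>Ps. Poly_Mapping.single (flag_of_lines Ps) 1 \<otimes> apartment Ps)"

text \<open>
  \<open>beta\<close> is injective on \<open>bar U\<close>, and \<open>St2 U\<close> lies in its image; the following is its inverse,
  to be applied to elements of \<open>St2 U\<close>.
\<close>

definition bar_embed ::
  "'v set \<Rightarrow> ('v set list \<times> 'v set list \<Rightarrow>\<^sub>0 rat) \<Rightarrow> ('v set list \<Rightarrow>\<^sub>0 rat)" where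
  "bar_embed U = inv_into (bar U) beta"

definition direct_decomp :: "'v set \<Rightarrow> 'v set \<Rightarrow> 'v set \<Rightarrow> bool" where
  "direct_decomp U U1 U2 \<longleftrightarrow> subspace U1 \<and> subspace U2 \<and>
    U1 \<inter> U2 = {0} \<and> U = {x + y | x y. x \<in> U1 \<and> y \<in> U2}"

definition deconc ::
  "('v set list \<Rightarrow>\<^sub>0 rat) \<Rightarrow> (('v set \<times> 'v set) \<times> ('v set list \<times> 'v set list) \<Rightarrow>\<^sub>0 rat)" where
  "deconc = lin (\<lambda>Ps. \<Sum>k\<le>length Ps.
    in_summand (span (\<Union>(set (take k Ps))), span (\<Union>(set (drop k Ps))))
      (Poly_Mapping.single (take k Ps) 1 \<otimes> Poly_Mapping.single (drop k Ps) 1))"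

text \<open>
  The coproduct \<open>\<Delta>\<close> is determined by \<open>(s \<otimes> s) \<circ> \<Delta> = deconc \<circ> s\<close>, where \<open>s\<close> is \<open>bar_embed\<close> and
  \<open>s \<otimes> s\<close> is taken in each summand.  Since \<open>s\<close> is a restriction of the inverse of \<open>beta\<close>, passing
  back from the bar complexes to \<open>St2\<close> along \<open>s \<otimes> s\<close> is applying \<open>beta \<otimes> beta\<close> in each summand.
\<close>

definition coproduct ::
  "'v set \<Rightarrow> ('v set list \<times> 'v set list \<Rightarrow>\<^sub>0 rat) \<Rightarrow>
    (('v set \<times> 'v set) \<times> (('v set list \<times> 'v set list) \<times> ('v set list \<times> 'v set list)) \<Rightarrow>\<^sub>0 rat)"
  where
  "coproduct U x = tensor_map id (tensor_map beta beta) (deconc (bar_embed U x))"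

text \<open>The subspace \<open>\<Oplus> St2 U1 \<otimes> St2 U2\<close>, over ordered pairs with internal direct sum \<open>U\<close>.\<close>

definition St2_sum ::
  "'v set \<Rightarrow>
    (('v set \<times> 'v set) \<times> (('v set list \<times> 'v set list) \<times> ('v set list \<times> 'v set list)) \<Rightarrow>\<^sub>0 rat) set"
  where
  "St2_sum U = module.span fscale
    {in_summand (U1, U2) (x \<otimes> y) | U1 U2 x y. direct_decomp U U1 U2 \<and> x \<in> St2 U1 \<and> y \<in> St2 U2}"


section \<open>The terms of the coproduct formula\<close>

definition sub_span :: "(nat \<Rightarrow> 'v) \<Rightarrow> nat set \<Rightarrow> 'v set" where
  "sub_span v I = span (v ` I)"

text \<open>
  For \<open>K = {k\<^sub>1 < k\<^sub>2 < \<dots>}\<close> the list of the subspaces \<open>X \<inter> \<langle>u\<^sub>k, Y\<rangle>\<close>.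
\<close>

definition meet_lines :: "'v set \<Rightarrow> (nat \<Rightarrow> 'v) \<Rightarrow> nat set \<Rightarrow> 'v set \<Rightarrow> 'v set list" where
  "meet_lines X u K Y = map (\<lambda>k. X \<inter> span (insert (u k) Y)) (sorted_list_of_set K)"

definition lower_term ::
  "nat \<Rightarrow> (nat \<Rightarrow> 'v) \<Rightarrow> (nat \<Rightarrow> 'v) \<Rightarrow> nat set \<Rightarrow> nat set \<Rightarrow>
    ('v set list \<times> 'v set list \<Rightarrow>\<^sub>0 rat)" where
  "lower_term d v w I J =
    vec_apartment (map v (sorted_list_of_set I)) \<otimes>
    apartment (meet_lines (sub_span v I) w ({1..d} - J) (sub_span w J))"

definition upper_term ::
  "nat \<Rightarrow> (nat \<Rightarrow> 'v) \<Rightarrow> (nat \<Rightarrow> 'v) \<Rightarrow> nat set \<Rightarrow> nat set \<Rightarrow>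
    ('v set list \<times> 'v set list \<Rightarrow>\<^sub>0 rat)" where
  "upper_term d v w I J =
    apartment (meet_lines (sub_span w J) v ({1..d} - I) (sub_span v I)) \<otimes>
    vec_apartment (map w (sorted_list_of_set J))"

end

text \<open>The permutation sending \<open>(1, \<dots>, d)\<close> to the elements of \<open>K\<close> in order, then those of \<open>L\<close>.\<close>

definition shuffle_perm :: "nat \<Rightarrow> nat set \<Rightarrow> nat set \<Rightarrow> nat \<Rightarrow> nat" where
  "shuffle_perm d K L =
    permutation_of_list (zip [1..<Suc d] (sorted_list_of_set K @ sorted_list_of_set L))"

end

theory Submission
  imports Defs "HOL-Combinatorics.Multiset_Permutations"
begin

text \<open>
  Expand \<open>A = \<Sum>\<^sub>\<sigma> \<plusminus>F\<^sub>\<sigma>\<close> into flags. For a complete flag \<open>F\<close>, the apartment \<open>B\<close> is a signed sum of apartments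
  containing \<open>F\<close>, one for each chamber of \<open>B\<close> opposite to \<open>F\<close>: both sides are cycles with the same
  coefficients at the chambers opposite to \<open>F\<close>, and a cycle vanishing at all of these is zero. Hence the
  bar element of \<open>A \<otimes> B\<close> is the signed sum, over the pairs \<open>(\<sigma>, \<tau>)\<close> of orderings whose flags are opposite,
  of the line decompositions with \<open>k\<close>-th line
  \<open>\<langle>v\<^bsub>\<sigma>1\<^esub>, \<dots>, v\<^bsub>\<sigma>k\<^esub>\<rangle> \<inter> \<langle>w\<^bsub>\<tau>k\<^esub>, \<dots>, w\<^bsub>\<tau>d\<^esub>\<rangle>\<close>. Deconcatenating at \<open>k\<close> splits \<open>\<sigma>\<close> and \<open>\<tau>\<close> into orderings of
  \<open>I = {\<sigma>1, \<dots>, \<sigma>k}\<close> and \<open>J = {\<tau>(k+1), \<dots>, \<tau>d}\<close> and of their complements. With the projections of the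
  \<open>w\<^sub>j\<close> to \<open>A\<^sub>I\<close> along \<open>B\<^sub>J\<close>, and of the \<open>v\<^sub>i\<close> to \<open>B\<^sub>J\<close> along \<open>A\<^sub>I\<close>, the two halves are exactly the
  bar elements of \<open>(A,B)\<^bsub>I,J\<^esub>\<close> and \<open>(A,B)\<^bsup>I,J\<^esup>\<close>.
\<close>

section \<open>Linear maps between free spaces\<close>

text \<open>An ordering \<open>ys\<close> of B enters through the reversed flag
  \<open>vflag w (rev ys)\<close>: this makes a cut at k pair the first k entries of
  \<open>xs\<close> with the remaining entries of \<open>ys\<close>, as deconcatenation does, and it
  is why the complement of J precedes J in tau_J. Reversal leaves no sign behind: among the chambers
  of the apartment on the frame of two opposite flags, only the reversed one is opposite to the
  first flag, and its sign (-1)^(n choose 2) also separates \<open>isgn (rev ys)\<close> from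
  \<open>isgn ys\<close>. Signs are counted by inversions of lists of naturals, because the
  inversions of a concatenation are those of the pieces and those across, and the latter depend only
  on the underlying sets; they become the two shuffle signs. Bases are likewise indexed by arbitrary
  finite sets of naturals, so that I, J and their complements need no renumbering. As
  \<open>bar_embed\<close> is an \<open>inv_into\<close>, exhibiting a preimage under
  \<open>beta\<close> is not enough: injectivity of \<open>beta\<close> on \<open>bar U\<close> is
  proved by reading coefficients at pairs of opposite flags.\<close>

interpretation free: vector_space fscale
  by (rule vector_space_fscale)

abbreviation flinear :: "(('a \<Rightarrow>\<^sub>0 rat) \<Rightarrow> ('b \<Rightarrow>\<^sub>0 rat)) \<Rightarrow> bool" where
  "flinear \<equiv> Vector_Spaces.linear fscale fscale"

lemma flinear_iff:
  "flinear f \<longleftrightarrow> (\<forall>x y. f (x + y) = f x + f y) \<and> (\<forall>c x. f (fscale c x) = fscale c (f x))"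
  unfolding Vector_Spaces.linear_iff by (simp add: vector_space_fscale)

lemma fscale_single: "fscale c (Poly_Mapping.single a r) = Poly_Mapping.single a (c * r)"
  by (auto intro!: poly_mapping_eqI simp: lookup_fscale lookup_single when_def)

text \<open>Allowing any finite superset of the support lets several elements be compared over one
  index set.\<close>

lemma lookup_lin:
  assumes "finite S" "Poly_Mapping.keys x \<subseteq> S"
  shows "Poly_Mapping.lookup (lin f x) b = (\<Sum>a\<in>S. Poly_Mapping.lookup x a * Poly_Mapping.lookup (f a) b)"
proof -
  have "Poly_Mapping.lookup (lin f x) b =
      (\<Sum>a\<in>Poly_Mapping.keys x. Poly_Mapping.lookup x a * Poly_Mapping.lookup (f a) b)"
    by (simp add: lin_def lookup_sum lookup_fscale)
  also have "\<dots> = (\<Sum>a\<in>S. Poly_Mapping.lookup x a * Poly_Mapping.lookup (f a) b)"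
    using assms by (intro sum.mono_neutral_left) (auto simp: in_keys_iff)
  finally show ?thesis .
qed

lemma flinear_lin: "flinear (lin f)"
  unfolding flinear_iff
proof (intro conjI allI)
  fix x y :: "'a \<Rightarrow>\<^sub>0 rat" and c :: rat
  let ?S = "Poly_Mapping.keys x \<union> Poly_Mapping.keys y"
  have "Poly_Mapping.keys (x + y) \<subseteq> ?S" by (rule keys_add)
  then show "lin f (x + y) = lin f x + lin f y"
    by (intro poly_mapping_eqI)
      (simp add: lookup_add lookup_lin[of ?S] ring_distribs sum.distrib)
  have "Poly_Mapping.keys (fscale c x) \<subseteq> ?S"
    by (auto simp: in_keys_iff lookup_fscale)
  then show "lin f (fscale c x) = fscale c (lin f x)"
    by (intro poly_mapping_eqI)
      (simp add: lookup_fscale lookup_lin[of ?S] sum_distrib_left mult.assoc)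
qed

lemma flinear_sum: "flinear f \<Longrightarrow> f (\<Sum>i\<in>S. g i) = (\<Sum>i\<in>S. f (g i))"
  by (rule module_hom.sum[OF module_hom_linearI])

lemma flinear_scale: "flinear f \<Longrightarrow> f (fscale c x) = fscale c (f x)"
  by (simp add: flinear_iff)

lemma flinear_add: "flinear f \<Longrightarrow> f (x + y) = f x + f y"
  by (simp add: flinear_iff)

lemma flinear_zero: "flinear f \<Longrightarrow> f 0 = 0"
  by (rule module_hom.zero[OF module_hom_linearI])

lemma lin_single: "lin f (Poly_Mapping.single a c) = fscale c (f a)"
  by (auto simp: lin_def)

lemma free_expansion:
  "x = (\<Sum>a\<in>Poly_Mapping.keys x. fscale (Poly_Mapping.lookup x a) (Poly_Mapping.single a 1))"
  by (rule poly_mapping_eqI)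
    (auto simp: lookup_sum fscale_single lookup_single when_def in_keys_iff)

lemma flinear_eqI:
  assumes "flinear f" "flinear g" "\<And>a. f (Poly_Mapping.single a 1) = g (Poly_Mapping.single a 1)"
  shows "f x = g x"
  by (subst (1 2) free_expansion) (simp add: assms flinear_sum flinear_scale)

lemma flinear_id: "flinear id"
  by (simp add: flinear_iff)

lemma flinear_compose: "flinear f \<Longrightarrow> flinear g \<Longrightarrow> flinear (\<lambda>x. f (g x))"
  by (simp add: flinear_iff)

lemma lookup_tensor:
  "Poly_Mapping.lookup (x \<otimes> y) p = Poly_Mapping.lookup x (fst p) * Poly_Mapping.lookup y (snd p)"
proof -
  have "Poly_Mapping.lookup (x \<otimes> y) p = (\<Sum>q\<in>Poly_Mapping.keys x \<times> Poly_Mapping.keys y.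
     (Poly_Mapping.lookup x (fst q) * Poly_Mapping.lookup y (snd q)) when q = p)"
    by (simp add: tensor_def lookup_sum lookup_single sum.cartesian_product split_def)
  also have "\<dots> = Poly_Mapping.lookup x (fst p) * Poly_Mapping.lookup y (snd p)"
    by (cases p) (auto simp: when_def in_keys_iff)
  finally show ?thesis .
qed

lemma tensor_single:
  "Poly_Mapping.single a r \<otimes> Poly_Mapping.single b s = Poly_Mapping.single (a, b) (r * s)"
  by (auto intro!: poly_mapping_eqI simp: lookup_tensor lookup_single when_def)

lemma flinear_tensor_left: "flinear (\<lambda>x. x \<otimes> y)"
  by (auto simp: flinear_iff lookup_tensor lookup_add lookup_fscale algebra_simps
      intro!: poly_mapping_eqI)

lemma flinear_tensor_right: "flinear (\<lambda>y. x \<otimes> y)"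
  by (auto simp: flinear_iff lookup_tensor lookup_add lookup_fscale algebra_simps
      intro!: poly_mapping_eqI)

lemmas tensor_sum_left = flinear_sum[OF flinear_tensor_left]
  and tensor_sum_right = flinear_sum[OF flinear_tensor_right]
  and tensor_fscale_left = flinear_scale[OF flinear_tensor_left]
  and tensor_fscale_right = flinear_scale[OF flinear_tensor_right]
  and tensor_zero_left = flinear_zero[OF flinear_tensor_left]
  and tensor_zero_right = flinear_zero[OF flinear_tensor_right]

lemma flinear_tensor_map: "flinear (tensor_map f g)"
  unfolding tensor_map_def by (rule flinear_lin)

lemma tensor_map_tensor:
  assumes f: "flinear f" and g: "flinear g"
  shows "tensor_map f g (x \<otimes> y) = f x \<otimes> g y"
proof -
  have *: "tensor_map f g (Poly_Mapping.single a 1 \<otimes> y) = f (Poly_Mapping.single a 1) \<otimes> g y" for a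
    by (rule flinear_eqI[of "\<lambda>y. tensor_map f g (_ \<otimes> y)" "\<lambda>y. _ \<otimes> g y"],
        rule flinear_compose[OF flinear_tensor_map flinear_tensor_right],
        rule flinear_compose[OF flinear_tensor_right g],
        simp add: tensor_single tensor_map_def lin_single)
  show ?thesis
    by (rule flinear_eqI[of "\<lambda>x. tensor_map f g (x \<otimes> y)" "\<lambda>x. f x \<otimes> g y"],
        rule flinear_compose[OF flinear_tensor_map flinear_tensor_left],
        rule flinear_compose[OF flinear_tensor_left f], rule *)
qed

lemma flinear_in_summand: "flinear (in_summand i)"
  unfolding in_summand_def by (rule flinear_tensor_right)

lemma tensor_map_in_summand:
  "flinear g \<Longrightarrow> tensor_map id g (in_summand i x) = in_summand i (g x)"
  by (simp add: in_summand_def tensor_map_tensor flinear_id)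

lemma keys_sum_single:
  "Poly_Mapping.keys (\<Sum>x\<in>S. Poly_Mapping.single (f x) (c x)) \<subseteq> f ` S"
  by (rule order.trans[OF keys_sum]) (auto split: if_splits)

lemma keys_sum_subset:
  "(\<And>i. i \<in> S \<Longrightarrow> Poly_Mapping.keys (f i) \<subseteq> T) \<Longrightarrow> Poly_Mapping.keys (sum f S) \<subseteq> T"
  by (rule order.trans[OF keys_sum]) blast

section \<open>Signs of orderings\<close>

text \<open>The sign of the permutation that sorts a list of distinct numbers.\<close>

fun isgn :: "nat list \<Rightarrow> int" where
  "isgn [] = 1"
| "isgn (x # xs) = (-1) ^ card {y \<in> set xs. y < x} * isgn xs"

text \<open>The sign of the inversions between two blocks when X is written before Y. For
  complementary sets this is the sign of the shuffle.\<close>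

definition cross_sgn :: "nat set \<Rightarrow> nat set \<Rightarrow> int" where
  "cross_sgn X Y = (-1) ^ card {(x, y) \<in> X \<times> Y. y < x}"

text \<open>Inversions lie inside one piece or across both, and those across depend only on the two
  sets. This lets sums over orderings factor once the sets are fixed.\<close>

lemma isgn_append:
  "distinct (xs @ ys) \<Longrightarrow> isgn (xs @ ys) = isgn xs * isgn ys * cross_sgn (set xs) (set ys)"
proof (induction xs)
  case (Cons a xs)
  have "{y \<in> set (xs @ ys). y < a} = {y \<in> set xs. y < a} \<union> {y \<in> set ys. y < a}"
    by auto
  then have 1: "card {y \<in> set (xs @ ys). y < a} = card {y \<in> set xs. y < a} + card {y \<in> set ys. y < a}"
    using Cons.prems by (simp add: card_Un_disjoint disjoint_iff)
  have "{(x, y) \<in> set (a # xs) \<times> set ys. y < x} =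
      {a} \<times> {y \<in> set ys. y < a} \<union> {(x, y) \<in> set xs \<times> set ys. y < x}"
    by auto
  moreover have "card ({a} \<times> {y \<in> set ys. y < a} \<union> {(x, y) \<in> set xs \<times> set ys. y < x}) =
     card ({a} \<times> {y \<in> set ys. y < a}) + card {(x, y) \<in> set xs \<times> set ys. y < x}"
    using Cons.prems by (intro card_Un_disjoint) (auto intro: finite_subset[of _ "set xs \<times> set ys"])
  ultimately have 2: "cross_sgn (set (a # xs)) (set ys) =
      (-1) ^ card {y \<in> set ys. y < a} * cross_sgn (set xs) (set ys)"
    by (simp add: cross_sgn_def card_cartesian_product power_add)
  show ?case
    using Cons unfolding append_Cons isgn.simps 1 2 by (simp add: power_add)
qed (simp add: cross_sgn_def)

lemma isgn_cases: "isgn xs = 1 \<or> isgn xs = -1"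
proof (induction xs)
  case (Cons a xs)
  then show ?case
    by (cases "even (card {y \<in> set xs. y < a})") auto
qed simp

lemma cross_sgn_Un:
  assumes "finite X" "finite Y" "finite Z" "Y \<inter> Z = {}"
  shows "cross_sgn X (Y \<union> Z) = cross_sgn X Y * cross_sgn X Z"
    and "cross_sgn (Y \<union> Z) X = cross_sgn Y X * cross_sgn Z X"
proof -
  have "card ({(x, y) \<in> X \<times> Y. y < x} \<union> {(x, y) \<in> X \<times> Z. y < x}) =
      card {(x, y) \<in> X \<times> Y. y < x} + card {(x, y) \<in> X \<times> Z. y < x}"
    using assms by (intro card_Un_disjoint)
      (auto intro: finite_subset[of _ "X \<times> Y"] finite_subset[of _ "X \<times> Z"])
  moreover have "{(x, y) \<in> X \<times> (Y \<union> Z). y < x} = {(x, y) \<in> X \<times> Y. y < x} \<union> {(x, y) \<in> X \<times> Z. y < x}"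
    by auto
  ultimately show "cross_sgn X (Y \<union> Z) = cross_sgn X Y * cross_sgn X Z"
    by (simp add: cross_sgn_def power_add)
  have "card ({(x, y) \<in> Y \<times> X. y < x} \<union> {(x, y) \<in> Z \<times> X. y < x}) =
      card {(x, y) \<in> Y \<times> X. y < x} + card {(x, y) \<in> Z \<times> X. y < x}"
    using assms by (intro card_Un_disjoint)
      (auto intro: finite_subset[of _ "Y \<times> X"] finite_subset[of _ "Z \<times> X"])
  moreover have "{(x, y) \<in> (Y \<union> Z) \<times> X. y < x} = {(x, y) \<in> Y \<times> X. y < x} \<union> {(x, y) \<in> Z \<times> X. y < x}"
    by auto
  ultimately show "cross_sgn (Y \<union> Z) X = cross_sgn Y X * cross_sgn Z X"
    by (simp add: cross_sgn_def power_add)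
qed

text \<open>Every pair is inverted in exactly one of the two orders of the blocks.\<close>

lemma cross_sgn_swap:
  assumes "finite X" "finite Y" "X \<inter> Y = {}"
  shows "cross_sgn X Y * cross_sgn Y X = (-1) ^ (card X * card Y)"
proof -
  let ?A = "{(x, y) \<in> X \<times> Y. y < x}" and ?B = "{(x, y) \<in> X \<times> Y. x < y}"
  have "bij_betw prod.swap {(x, y) \<in> Y \<times> X. y < x} ?B"
    by (auto simp: bij_betw_def inj_on_def image_iff)
  then have "card {(x, y) \<in> Y \<times> X. y < x} = card ?B"
    by (rule bij_betw_same_card)
  moreover have "card (?A \<union> ?B) = card ?A + card ?B"
    using assms by (intro card_Un_disjoint) (auto intro: finite_subset[of _ "X \<times> Y"])
  moreover have "?A \<union> ?B = X \<times> Y"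
    using assms(3) by (auto simp: neq_iff)
  ultimately show ?thesis
    by (simp add: cross_sgn_def card_cartesian_product flip: power_add)
qed

text \<open>After splitting into five blocks, only the factors between a, b and \<open>ys\<close>
  can change. The pair (a, b) contributes -1, and the changes from moving a and b across
  \<open>ys\<close> cancel.\<close>

lemma isgn_swap:
  assumes "distinct (xs @ a # ys @ b # zs)"
  shows "isgn (xs @ b # ys @ a # zs) = - isgn (xs @ a # ys @ b # zs)"
proof -
  \<comment> \<open>Stated for arbitrary a and b, so that the same expansion serves both
    orders.\<close>
  have 0: "isgn (xs @ [a] @ ys @ [b] @ zs) =
    isgn xs * isgn ys * isgn zs * cross_sgn (set xs) {a} * cross_sgn (set xs) (set ys) *
    cross_sgn (set xs) {b} * cross_sgn (set xs) (set zs) *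
    cross_sgn {a} (set ys) * cross_sgn {a} {b} * cross_sgn {a} (set zs) *
    cross_sgn (set ys) {b} * cross_sgn (set ys) (set zs) * cross_sgn {b} (set zs)"
    if "distinct (xs @ [a] @ ys @ [b] @ zs)" for a b
  proof -
    have "isgn (xs @ [a] @ ys @ [b] @ zs) = isgn xs * (isgn ys * isgn zs * cross_sgn {b} (set zs)
        * cross_sgn (set ys) ({b} \<union> set zs) * cross_sgn {a} (set ys \<union> ({b} \<union> set zs)))
        * cross_sgn (set xs) ({a} \<union> (set ys \<union> ({b} \<union> set zs)))"
      using that
      by (subst isgn_append[of xs], simp, subst isgn_append[of "[a]"], simp,
          subst isgn_append[of ys], simp, subst isgn_append[of "[b]"], simp,
          simp add: insert_commute)
    moreover have "cross_sgn (set ys) ({b} \<union> set zs) = cross_sgn (set ys) {b} * cross_sgn (set ys) (set zs)"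
      "cross_sgn {a} (set ys \<union> ({b} \<union> set zs)) = cross_sgn {a} (set ys) * cross_sgn {a} ({b} \<union> set zs)"
      "cross_sgn {a} ({b} \<union> set zs) = cross_sgn {a} {b} * cross_sgn {a} (set zs)"
      "cross_sgn (set xs) ({a} \<union> (set ys \<union> ({b} \<union> set zs))) =
        cross_sgn (set xs) {a} * cross_sgn (set xs) (set ys \<union> ({b} \<union> set zs))"
      "cross_sgn (set xs) (set ys \<union> ({b} \<union> set zs)) = cross_sgn (set xs) (set ys) * cross_sgn (set xs) ({b} \<union> set zs)"
      "cross_sgn (set xs) ({b} \<union> set zs) = cross_sgn (set xs) {b} * cross_sgn (set xs) (set zs)"
      using that by (intro cross_sgn_Un; auto)+
    ultimately show ?thesis by (simp only: mult.assoc mult.commute mult.left_commute)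
  qed
  have c: "cross_sgn X Y = 1 \<or> cross_sgn X Y = -1" for X Y
    unfolding cross_sgn_def by (simp add: minus_one_power_iff)
  have "cross_sgn {a} {b} * cross_sgn {b} {a} = -1"
    using assms by (subst cross_sgn_swap) auto
  then have *: "cross_sgn {b} {a} = - cross_sgn {a} {b}"
    using c[of "{a}" "{b}"] by auto
  \<comment> \<open>Both products equal (-1)^|ys|. As all factors are 1 or -1, they can be moved
    freely between the two sides.\<close>
  have "cross_sgn {a} (set ys) * cross_sgn (set ys) {a} =
      cross_sgn {b} (set ys) * cross_sgn (set ys) {b}"
    using assms by (subst (1 2) cross_sgn_swap) auto
  then have **: "cross_sgn {b} (set ys) * cross_sgn (set ys) {a} = cross_sgn {a} (set ys) * cross_sgn (set ys) {b}"
    using c[of "{a}" "set ys"] c[of "set ys" "{a}"] c[of "{b}" "set ys"] c[of "set ys" "{b}"]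
    by (elim disjE) simp_all
  have "isgn (xs @ [b] @ ys @ [a] @ zs) =
    (cross_sgn {b} (set ys) * cross_sgn (set ys) {a}) * cross_sgn {b} {a} * (
    isgn xs * isgn ys * isgn zs * cross_sgn (set xs) {a} * cross_sgn (set xs) (set ys) *
    cross_sgn (set xs) {b} * cross_sgn (set xs) (set zs) *
    cross_sgn {a} (set zs) * cross_sgn (set ys) (set zs) * cross_sgn {b} (set zs))"
    using assms by (subst 0, force) (simp only: mult_ac)
  also have "\<dots> = - isgn (xs @ [a] @ ys @ [b] @ zs)"
    using assms unfolding * ** by (subst 0, force) (simp only: mult_ac mult_minus_left mult_minus_right)
  finally show ?thesis by simp
qed

lemma isgn_sorted: "sorted xs \<Longrightarrow> isgn xs = 1"
proof (induction xs)
  case (Cons a xs)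
  then have *: "card {y \<in> set xs. y < a} = 0" by (auto simp: card_eq_0_iff)
  from Cons show ?case unfolding isgn.simps * by simp
qed simp

lemma isgn_map_strict_mono_on:
  "strict_mono_on (set xs) f \<Longrightarrow> isgn (map f xs) = isgn xs"
proof (induction xs)
  case (Cons a xs)
  have "{y \<in> set (map f xs). y < f a} = f ` {y \<in> set xs. y < a}"
    using Cons.prems by (auto simp: strict_mono_on_less)
  moreover have "inj_on f {y \<in> set xs. y < a}"
    by (rule inj_on_subset[OF strict_mono_on_imp_inj_on[OF Cons.prems]]) auto
  ultimately have "card {y \<in> set (map f xs). y < f a} = card {y \<in> set xs. y < a}"
    by (simp add: card_image)
  moreover have "strict_mono_on (set xs) f"
    using Cons.prems by (auto simp: strict_mono_on_def)
  ultimately show ?case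
    using Cons.IH unfolding isgn.simps list.map by simp
qed simp

text \<open>The link between inversion counts and \<open>sign\<close>: build p from transpositions,
  each of which negates both sides.\<close>

lemma isgn_map_permutes:
  assumes "p permutes set xs" "distinct xs"
  shows "isgn (map p xs) = sign p * isgn xs"
  using assms(1) finite_set
proof (induction rule: permutes_induct)
  case (swap a b p)
  let ?l = "map p xs"
  have p: "set ?l = set xs" "distinct ?l"
    using swap assms(2) by (auto simp: permutes_image distinct_map intro: permutes_inj_on)
  \<comment> \<open>On a list with distinct entries, exchanging the values a and b is the same as
    exchanging their two positions.\<close>
  have step: "isgn (map (transpose a b) (ys @ a # zs @ b # us)) = - isgn (ys @ a # zs @ b # us)"
    if "distinct (ys @ a # zs @ b # us)" for a b ys zs us
  proof -
    have "map (transpose a b) l = l" if "a \<notin> set l" "b \<notin> set l" for l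
      using that by (induction l) auto
    then show ?thesis
      using that isgn_swap[OF that] by simp
  qed
  obtain ys r where r: "?l = ys @ a # r" using swap(1) p by (metis split_list)
  have "b \<in> set ys \<or> b \<in> set r" using swap p r by (metis Un_iff set_ConsD set_append)
  then have "isgn (map (transpose a b) ?l) = - isgn ?l"
  proof
    assume "b \<in> set r"
    then obtain zs us where "r = zs @ b # us" by (metis split_list)
    then show ?thesis using step[of ys a zs b us] p r by simp
  next
    assume "b \<in> set ys"
    then obtain zs us where "ys = zs @ b # us" by (metis split_list)
    then show ?thesis using step[of zs b us a r] p r by (simp add: transpose_commute)
  qed
  moreover have "sign (transpose a b \<circ> p) = - sign p"
    using swap by (subst sign_compose) (auto simp: sign_swap_id permutation_swap_id
        intro: permutation_permutes[THEN iffD2])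
  ultimately show ?case using swap by (simp only: map_map[symmetric])
qed simp

text \<open>The permutation carries the increasing list to two sorted blocks, which have no inner
  inversions, so only the inversions across remain.\<close>

lemma sign_shuffle_perm:
  assumes "K \<subseteq> {1..d}" "L = {1..d} - K"
  shows "sign (shuffle_perm d K L) = cross_sgn K L"
proof -
  let ?l = "sorted_list_of_set K @ sorted_list_of_set L"
  let ?z = "zip [1..<Suc d] ?l"
  have fin: "finite K" "finite L" using assms by (auto intro: finite_subset)
  have l: "distinct ?l" "set ?l = {1..d}" using assms fin by auto
  then have len: "length ?l = d" by (metis card_atLeastAtMost diff_Suc_1 distinct_card)
  have lp: "list_permutes ?z {1..d}"
    unfolding list_permutes_def using l len by auto
  have p: "shuffle_perm d K L permutes {1..d}"
    unfolding shuffle_perm_def using lp by (rule permutation_of_list_permutes)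
  have "map (shuffle_perm d K L) [1..<Suc d] = ?l"
  proof (rule nth_equalityI)
    fix i assume "i < length (map (shuffle_perm d K L) [1..<Suc d])"
    then have i: "i < d" by (simp del: upt_Suc)
    have "(Suc i, ?l ! i) \<in> set ?z"
      using i len by (auto simp: in_set_zip intro!: exI[of _ i] simp del: upt_Suc)
    then have "shuffle_perm d K L (Suc i) = ?l ! i"
      unfolding shuffle_perm_def by (rule permutation_of_list_unique[OF lp])
    then show "map (shuffle_perm d K L) [1..<Suc d] ! i = ?l ! i"
      using i by (simp del: upt_Suc)
  qed (use len in simp)
  then have "isgn ?l = sign (shuffle_perm d K L)"
    using isgn_map_permutes[of "shuffle_perm d K L" "[1..<Suc d]"] p
    by (simp add: isgn_sorted atLeastLessThanSuc_atLeastAtMost del: upt_Suc)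
  then show ?thesis
    using isgn_append[OF l(1)] fin by (simp add: isgn_sorted)
qed

lemma isgn_rev:
  "distinct xs \<Longrightarrow> isgn (rev xs) = (-1) ^ (length xs choose 2) * isgn xs"
proof (induction xs)
  case (Cons a xs)
  have "isgn (rev xs @ [a]) = isgn (rev xs) * cross_sgn (set xs) {a}"
    using Cons.prems by (subst isgn_append) auto
  moreover have "isgn (a # xs) = isgn xs * cross_sgn {a} (set xs)"
    using Cons.prems isgn_append[of "[a]" xs] by simp
  moreover have "cross_sgn {a} (set xs) * cross_sgn (set xs) {a} = (-1) ^ length xs"
    using Cons.prems by (subst cross_sgn_swap) (auto simp: distinct_card)
  moreover have "cross_sgn {a} (set xs) * cross_sgn {a} (set xs) = 1"
    by (simp add: cross_sgn_def flip: power_add)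
  ultimately have "isgn (rev (a # xs)) = isgn (rev xs) * (-1) ^ length xs * cross_sgn {a} (set xs)"
    by (metis mult.assoc mult.commute mult.right_neutral rev.simps(2))
  then show ?case
    using Cons \<open>isgn (a # xs) = _\<close> by (simp add: numeral_2_eq_2 power_add mult_ac del: isgn.simps)
qed (simp add: numeral_2_eq_2)

section \<open>Orderings of finite index sets\<close>

lemma permutations_of_setE:
  assumes "xs \<in> permutations_of_set I"
  shows "set xs = I" "distinct xs" "length xs = card I" "finite I"
  using permutations_of_setD[OF assms] by (auto simp: distinct_card)

lemma bij_betw_permutes_permutations_of_set:
  assumes "distinct s"
  shows "bij_betw (\<lambda>\<sigma>. permute_list \<sigma> s) {\<sigma>. \<sigma> permutes {..<length s}} (permutations_of_set (set s))"
proof -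
  let ?f = "\<lambda>\<sigma>. permute_list \<sigma> s" and ?A = "{\<sigma>. \<sigma> permutes {..<length s}}"
  have inj: "inj_on ?f ?A"
  proof (rule inj_onI, rule ext)
    fix \<sigma> \<tau> i assume st: "\<sigma> \<in> ?A" "\<tau> \<in> ?A" "permute_list \<sigma> s = permute_list \<tau> s"
    show "\<sigma> i = \<tau> i"
    proof (cases "i < length s")
      case True
      then have "s ! \<sigma> i = s ! \<tau> i"
        using st permute_list_nth[of \<sigma> s i] permute_list_nth[of \<tau> s i] by simp
      moreover have "\<sigma> i < length s" "\<tau> i < length s"
        using True st permutes_in_image[of \<sigma> "{..<length s}" i] permutes_in_image[of \<tau> "{..<length s}" i]
        by auto
      ultimately show ?thesis using assms by (simp add: nth_eq_iff_index_eq)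
    next
      case False
      then show ?thesis using st by (auto simp: permutes_def)
    qed
  qed
  moreover have "?f ` ?A = permutations_of_set (set s)"
  proof (rule card_subset_eq)
    show "?f ` ?A \<subseteq> permutations_of_set (set s)" using assms by (auto simp: permutations_of_set_def)
    show "card (?f ` ?A) = card (permutations_of_set (set s))"
      using assms by (simp add: card_image[OF inj] card_permutations distinct_card)
  qed simp
  ultimately show ?thesis by (simp add: bij_betw_def)
qed

text \<open>The bound leaves only n - 1 for the first entry, then only n - 2 for the second, and so
  on. This is the combinatorial core of the uniqueness of the opposite chamber in an
  apartment.\<close>

lemma eq_rev_upt:
  assumes xs: "xs \<in> permutations_of_set {..<n}" and ge: "\<And>m. m < n \<Longrightarrow> n - Suc m \<le> xs ! m"
  shows "xs = rev [0..<n]"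
proof -
  note p = permutations_of_setE[OF xs]
  have "m < n \<Longrightarrow> xs ! m = n - Suc m" for m
  proof (induction m rule: less_induct)
    case (less m)
    have "xs ! m < n" using p less.prems nth_mem[of m xs] by auto
    show ?case
    proof (rule ccontr)
      assume "xs ! m \<noteq> n - Suc m"
      then have gt: "xs ! m > n - Suc m" using ge[OF less.prems] by simp
      \<comment> \<open>The earlier position at which, by induction, the value \<open>xs ! m\<close>
        has already been used.\<close>
      let ?k = "n - Suc (xs ! m)"
      have "?k < m" using gt \<open>xs ! m < n\<close> by simp
      then have "xs ! ?k = n - Suc ?k" using less.IH[of ?k] less.prems by linarith
      also have "\<dots> = xs ! m" using \<open>xs ! m < n\<close> by simp
      finally show False using \<open>?k < m\<close> less.prems p nth_eq_iff_index_eq[of xs ?k m] by simp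
    qed
  qed
  then show ?thesis using p by (intro nth_equalityI) (simp_all add: rev_nth)
qed

text \<open>Cutting both orderings at k: I collects the head of \<open>xs\<close> and J the tail of
  \<open>ys\<close>. Since the cut is common, I and the complement of J have equal size, and k is
  recovered as \<open>card I\<close>.\<close>

lemma sum_permutations_split:
  assumes "finite K"
  shows "(\<Sum>xs\<in>permutations_of_set K. \<Sum>ys\<in>permutations_of_set K. \<Sum>k\<le>card K. g k xs ys) =
    (\<Sum>(I, J)\<in>{(I, J). I \<subseteq> K \<and> J \<subseteq> K \<and> card I = card (K - J)}.
      \<Sum>xs\<in>permutations_of_set I. \<Sum>ys\<in>permutations_of_set (K - J).
      \<Sum>xs'\<in>permutations_of_set (K - I). \<Sum>ys'\<in>permutations_of_set J.
        g (card I) (xs @ xs') (ys @ ys'))"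
proof -
  let ?P = permutations_of_set
  let ?Q = "{(I, J). I \<subseteq> K \<and> J \<subseteq> K \<and> card I = card (K - J)}"
  have finQ: "finite ?Q"
    by (rule finite_subset[of _ "Pow K \<times> Pow K"]) (use assms in auto)
  have "(\<Sum>xs\<in>?P K. \<Sum>ys\<in>?P K. \<Sum>k\<le>card K. g k xs ys) =
      (\<Sum>(xs, ys, k)\<in>?P K \<times> ?P K \<times> {..card K}. g k xs ys)"
    by (simp add: sum.cartesian_product)
  also have "\<dots> = (\<Sum>((I, J), xs, ys, xs', ys')\<in>(SIGMA (I, J):?Q. ?P I \<times> ?P (K - J) \<times> ?P (K - I) \<times> ?P J).
      g (card I) (xs @ xs') (ys @ ys'))"
  proof (rule sum.reindex_bij_witness[of _
      "\<lambda>((I, J), xs, ys, xs', ys'). (xs @ xs', ys @ ys', card I)"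
      "\<lambda>(xs, ys, k). ((set (take k xs), set (drop k ys)), take k xs, take k ys, drop k xs, drop k ys)"], goal_cases)
    case (1 a)
    obtain xs ys k where a: "a = (xs, ys, k)" by (cases a)
    have "distinct xs" "length xs = card K" "k \<le> card K"
      using 1 permutations_of_setE[of xs K] unfolding a by auto
    then show ?case unfolding a by (simp add: distinct_card)
  next
    case (2 a)
    obtain xs ys k where a: "a = (xs, ys, k)" by (cases a)
    have x: "set xs = K" "distinct xs" "length xs = card K" "set ys = K" "distinct ys" "length ys = card K"
      "k \<le> card K"
      using 2 permutations_of_setE unfolding a by auto
    have split: "set (take k zs) \<inter> set (drop k zs) = {} \<and> set (take k zs) \<union> set (drop k zs) = K"
      if "set zs = K" "distinct zs" for zs
      using that set_take_disj_set_drop_if_distinct[of zs k k] set_append[of "take k zs" "drop k zs"] by simp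
    have "K - set (drop k ys) = set (take k ys)" "K - set (take k xs) = set (drop k xs)"
      using split[of xs] split[of ys] x by blast+
    moreover have "set (take k xs) \<subseteq> K" "set (drop k ys) \<subseteq> K" using split[of xs] split[of ys] x by blast+
    ultimately show ?case unfolding a
      using x by (auto simp: permutations_of_set_def distinct_card)
  next
    case (3 b)
    obtain I J xs ys xs' ys' where b: "b = ((I, J), xs, ys, xs', ys')" by (metis surj_pair)
    have x: "set xs = I" "set xs' = K - I" "set ys = K - J" "set ys' = J" "card I = card (K - J)"
      "distinct xs" "distinct ys"
      using 3 unfolding b by (auto simp: permutations_of_set_def)
    then have "length xs = card I" "length ys = card I" by (metis distinct_card)+
    with x(1-4) show ?case unfolding b by simp
  next
    case (4 b)
    then show ?case using assms
      by (auto simp: permutations_of_set_def card_mono intro: finite_subset)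
  next
    case (5 a)
    obtain xs ys k where a: "a = (xs, ys, k)" by (cases a)
    have "distinct xs" "length xs = card K" "k \<le> card K"
      using 5 permutations_of_setE[of xs K] unfolding a by auto
    then show ?case unfolding a by (simp add: distinct_card)
  qed
  also have "\<dots> = (\<Sum>q\<in>?Q. \<Sum>(xs, ys, xs', ys')\<in>?P (fst q) \<times> ?P (K - snd q) \<times> ?P (K - fst q) \<times> ?P (snd q).
      g (card (fst q)) (xs @ xs') (ys @ ys'))"
    using finQ by (subst sum.Sigma) (auto simp: split_def intro!: sum.cong)
  also have "\<dots> = (\<Sum>(I, J)\<in>?Q. \<Sum>xs\<in>?P I. \<Sum>ys\<in>?P (K - J). \<Sum>xs'\<in>?P (K - I). \<Sum>ys'\<in>?P J.
        g (card I) (xs @ xs') (ys @ ys'))"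
    by (simp add: sum.cartesian_product split_def)
  finally show ?thesis .
qed

section \<open>Linear algebra\<close>

context steinberg
begin

lemma independent_Un_direct:
  assumes "independent A" "independent B" "finite B" "span A \<inter> span B = {0}"
  shows "independent (A \<union> B)"
  using assms(3,2,4)
proof (induction B)
  case (insert b B)
  have sB: "span B \<subseteq> span (insert b B)" by (rule span_mono) auto
  have "span A \<inter> span B = {0}" using insert.prems(2) sB span_zero by blast
  then have IH: "independent (A \<union> B)"
    using insert independent_mono[of "insert b B" B] by auto
  have "b \<notin> span (A \<union> B)"
  proof
    assume "b \<in> span (A \<union> B)"
    then obtain x y where xy: "b = x + y" "x \<in> span A" "y \<in> span B"
      by (auto simp: span_Un)
    have "b - y \<in> span (insert b B)"
      using xy(3) sB by (intro span_diff) (auto intro: span_base)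
    then have "x \<in> span A \<inter> span (insert b B)" using xy by simp
    then have "x = 0" using insert.prems(2) xy(2) by blast
    then have "b \<in> span B" using xy by simp
    then show False using insert by (simp add: independent_insert)
  qed
  then show ?case using IH independent_insertI[of b "A \<union> B"] by simp
qed (use assms in simp)

lemma direct_disjoint:
  assumes "independent A" "span A \<inter> span B = {0}"
  shows "A \<inter> B = {}"
proof (rule ccontr)
  assume "A \<inter> B \<noteq> {}"
  then obtain x where "x \<in> A" "x \<in> B" by auto
  then have "x = 0" using assms(2) span_base by blast
  then show False using assms(1) \<open>x \<in> A\<close> dependent_zero by blast
qed

text \<open>Dedekind's modular law in the case where A and B meet trivially.\<close>

lemma Int_span_Un_modular:
  assumes "subspace X" "subspace A" "subspace B" "X \<subseteq> A" "A \<inter> B = {0}"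
  shows "A \<inter> span (X \<union> B) = X"
proof
  show "A \<inter> span (X \<union> B) \<subseteq> X"
  proof
    fix a assume a: "a \<in> A \<inter> span (X \<union> B)"
    have "span X = X" "span B = B" using assms by simp_all
    with a obtain x y where xy: "a = x + y" "x \<in> X" "y \<in> B"
      unfolding span_Un by blast
    have "a - x \<in> A" using a xy assms by (intro subspace_diff) auto
    then have "y \<in> A \<inter> B" using xy by simp
    then show "a \<in> X" using assms xy by simp
  qed
qed (use assms in \<open>auto intro: span_base\<close>)

text \<open>The ambient type may be infinite-dimensional, so finiteness is always supplied by a
  finite set B spanning an enclosing space.\<close>

lemma subspace_basis:
  assumes "subspace S" "S \<subseteq> span B" "finite B"
  obtains C where "finite C" "independent C" "span C = S" "card C = dim S"
proof -
  obtain C where C: "C \<subseteq> S" "independent C" "S \<subseteq> span C" "card C = dim S"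
    by (rule basis_exists)
  have "finite C" using independent_span_bound[OF assms(3) C(2)] C(1) assms(2) by blast
  moreover have "span C = S" using C assms by (metis span_subspace)
  ultimately show thesis using C that by blast
qed

lemma dim_psubset_subspace:
  assumes "subspace S" "subspace T" "S \<subset> T" "T \<subseteq> span B" "finite B"
  shows "dim S < dim T"
proof -
  obtain C where C: "finite C" "independent C" "span C = S" "card C = dim S"
    using subspace_basis[of S B] assms by blast
  obtain D where D: "finite D" "independent D" "span D = T" "card D = dim T"
    using subspace_basis[of T B] assms by blast
  obtain x where x: "x \<in> T" "x \<notin> S" using assms(3) by auto
  have "independent (insert x C)" using C x independent_insertI[of x C] by auto
  moreover have "insert x C \<subseteq> span D" using x C D assms(3) span_base by blast
  ultimately have "card (insert x C) \<le> card D"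
    using independent_span_bound[OF D(1)] by blast
  moreover have "x \<notin> C" using x C span_base by blast
  ultimately show ?thesis using C D by simp
qed

lemma span_insert_cong: "span A = span B \<Longrightarrow> span (insert x A) = span (insert x B)"
  by (simp add: span_insert)

lemma span_Un_cong: "span A = span A' \<Longrightarrow> span B = span B' \<Longrightarrow> span (A \<union> B) = span (A' \<union> B')"
  by (simp add: span_Un)

lemma span_Un_direct_eq:
  assumes U: "subspace U" "U \<subseteq> span C" "finite C"
    and A: "independent A" "A \<subseteq> U" and B: "independent B" "B \<subseteq> U" "finite A" "finite B"
    and AB: "span A \<inter> span B = {0}" "card A + card B = dim U"
  shows "span (A \<union> B) = U"
proof (rule ccontr)
  assume ne: "span (A \<union> B) \<noteq> U"
  have "span (A \<union> B) \<subseteq> U" using A B U by (intro span_minimal) auto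
  then have "dim (span (A \<union> B)) < dim U"
    using U ne by (intro dim_psubset_subspace[of _ _ C]) auto
  moreover have "dim (span (A \<union> B)) = card (A \<union> B)"
    by (intro dim_span_eq_card_independent independent_Un_direct A B AB)
  moreover have "card (A \<union> B) = card A + card B"
    using B direct_disjoint[OF A(1) AB(1)] by (intro card_Un_disjoint)
  ultimately show False using AB by simp
qed

section \<open>Cycles in the Tits building\<close>

lemma length_omit: "i < length xs \<Longrightarrow> length (omit i xs) = length xs - 1"
  by (simp add: omit_def)

lemma nth_omit: "i < length xs \<Longrightarrow> omit i xs ! j = xs ! (if j < i then j else Suc j)"
  by (auto simp: omit_def nth_append min_def)

lemma complete_flags_nth:
  assumes "G \<in> complete_flags U"
  shows "length G = Suc (dim U)" "G ! 0 = {0}" "G ! dim U = U"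
    and "i \<le> dim U \<Longrightarrow> subspace (G ! i)"
    and "i < j \<Longrightarrow> j \<le> dim U \<Longrightarrow> G ! i \<subset> G ! j"
proof -
  show l: "length G = Suc (dim U)" using assms by (simp add: complete_flags_def)
  then have "G \<noteq> []" by auto
  then show "G ! 0 = {0}" "G ! dim U = U"
    using assms l by (auto simp: complete_flags_def hd_conv_nth last_conv_nth)
  show "i \<le> dim U \<Longrightarrow> subspace (G ! i)" using assms l by (auto simp: complete_flags_def)
  show "i < j \<Longrightarrow> j \<le> dim U \<Longrightarrow> G ! i \<subset> G ! j"
    using assms l sorted_wrt_nth_less[of "(\<subset>)" G i j] by (auto simp: complete_flags_def)
qed

lemma complete_flags_mono:
  "G \<in> complete_flags U \<Longrightarrow> i \<le> j \<Longrightarrow> j \<le> dim U \<Longrightarrow> G ! i \<subseteq> G ! j"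
  using complete_flags_nth(5)[of G U i j] by (cases "i = j") auto

text \<open>Strict growth from dimension 0 upwards gives one bound, strict descent from
  \<open>dim U\<close> downwards the other.\<close>

lemma complete_flags_dim:
  assumes G: "G \<in> complete_flags U" and U: "U = span B" "finite B" and i: "i \<le> dim U"
  shows "dim (G ! i) = i"
proof -
  have step: "dim (G ! j) < dim (G ! Suc j)" if "Suc j \<le> dim U" for j
    using complete_flags_nth[OF G] complete_flags_mono[OF G, of "Suc j" "dim U"] that U
    by (intro dim_psubset_subspace[of _ _ B]) auto
  have "i \<le> dim (G ! i)" using i
  proof (induction i)
    case (Suc i)
    then show ?case using step[of i] by simp
  qed simp
  moreover have "dim (G ! i) \<le> i" using i
  proof (induction rule: inc_induct)
    case base
    then show ?case using complete_flags_nth(3)[OF G] by simp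
  next
    case (step m)
    then show ?case using \<open>\<And>j. Suc j \<le> dim U \<Longrightarrow> _\<close>[of m] by simp
  qed
  ultimately show ?thesis by simp
qed

text \<open>No subspace fits strictly between two consecutive entries, whose dimensions differ by
  one.\<close>

lemma complete_flags_step:
  assumes G: "G \<in> complete_flags U" and U: "U = span B" "finite B"
    and i: "Suc i \<le> dim U" and x: "x \<in> G ! Suc i" "x \<notin> G ! i"
  shows "G ! Suc i = span (insert x (G ! i))"
proof (rule ccontr)
  assume ne: "G ! Suc i \<noteq> span (insert x (G ! i))"
  let ?S = "span (insert x (G ! i))"
  have sub: "subspace (G ! i)" "subspace (G ! Suc i)" "G ! i \<subset> G ! Suc i" "G ! Suc i \<subseteq> span B"
    using complete_flags_nth[OF G] complete_flags_mono[OF G, of "Suc i" "dim U"] i U by auto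
  have "?S \<subset> G ! Suc i" using span_minimal[of "insert x (G ! i)" "G ! Suc i"] sub x ne by auto
  then have 1: "dim ?S < dim (G ! Suc i)"
    using sub U by (intro dim_psubset_subspace[of _ _ B]) auto
  have "G ! i \<subset> ?S" using x(2) span_superset[of "insert x (G ! i)"] by auto
  then have "dim (G ! i) < dim ?S"
    using sub U \<open>?S \<subset> G ! Suc i\<close> by (intro dim_psubset_subspace[of _ _ B]) auto
  then show False using 1 complete_flags_dim[OF G U, of i] complete_flags_dim[OF G U, of "Suc i"] i
    by simp
qed

text \<open>The dimensions that survive in a panel show which position was omitted, so two chambers
  sharing a panel omit the same position.\<close>

lemma omit_flags_eq:
  assumes G: "G \<in> complete_flags U" and G': "G' \<in> complete_flags U" and U: "U = span B" "finite B"
    and i: "i < dim U" "k < dim U" and eq: "omit k G' = omit i G"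
  shows "k = i" "j \<le> dim U \<Longrightarrow> j \<noteq> i \<Longrightarrow> G' ! j = G ! j"
proof -
  note l = complete_flags_nth(1)[OF G] complete_flags_nth(1)[OF G']
  have eqn: "G' ! (if j < k then j else Suc j) = G ! (if j < i then j else Suc j)" for j
    using arg_cong[OF eq, of "\<lambda>l. l ! j"] i l by (simp only: nth_omit)
  have "(if j < k then j else Suc j) = (if j < i then j else Suc j)" if "j < dim U" for j
    using arg_cong[OF eqn[of j], of dim] that
      complete_flags_dim[OF G' U, of "if j < k then j else Suc j"]
      complete_flags_dim[OF G U, of "if j < i then j else Suc j"]
    by (auto split: if_splits)
  from this[of k] this[of i] show "k = i" using i by (auto split: if_splits)
  show "G' ! j = G ! j" if "j \<le> dim U" "j \<noteq> i"
  proof (cases "j < i")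
    case True
    then show ?thesis using eqn[of j] \<open>k = i\<close> by simp
  next
    case False
    then have "\<not> j - 1 < i" "Suc (j - 1) = j" using that by auto
    then show ?thesis using eqn[of "j - 1"] unfolding \<open>k = i\<close> by metis
  qed
qed

lemma flinear_boundary: "flinear boundary"
  unfolding boundary_def by (rule flinear_lin)

text \<open>The boundary coefficient at the panel of \<open>G\<close> obtained by omitting \<open>G ! i\<close> is, up to sign,
  the sum of the coefficients of all chambers containing this panel.\<close>

lemma cycle_panel:
  assumes z: "z \<in> St U" and U: "U = span B" "finite B" and G: "G \<in> complete_flags U"
    and i: "0 < i" "i < dim U"
    and others: "\<And>G'. G' \<in> complete_flags U \<Longrightarrow> G' \<noteq> G \<Longrightarrow>
      (\<And>j. j \<le> dim U \<Longrightarrow> j \<noteq> i \<Longrightarrow> G' ! j = G ! j) \<Longrightarrow> Poly_Mapping.lookup z G' = 0"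
  shows "Poly_Mapping.lookup z G = 0"
proof -
  let ?b = "\<lambda>G'. \<Sum>k\<in>{1..<length G' - 1}. Poly_Mapping.single (omit k G') ((-1) ^ (k - 1) :: rat)"
  have keys: "Poly_Mapping.keys z \<subseteq> complete_flags U" and "boundary z = 0"
    using z by (auto simp: St_def)
  \<comment> \<open>G is inserted because it need not belong to the support of z.\<close>
  let ?S = "insert G (Poly_Mapping.keys z)"
  have zero: "Poly_Mapping.lookup z G' * Poly_Mapping.lookup (?b G') (omit i G) = 0"
    if "G' \<in> ?S - {G}" for G'
  proof (cases "\<exists>k\<in>{1..<length G' - 1}. omit k G' = omit i G")
    case True
    have G': "G' \<in> complete_flags U" using that keys by auto
    from True obtain k where k: "k < dim U" "omit k G' = omit i G"
      using complete_flags_nth(1)[OF G'] by auto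
    show ?thesis
      using others[OF G'] omit_flags_eq(2)[OF G G' U i(2) k] that by auto
  next
    case False
    then show ?thesis
      by (auto simp: lookup_sum lookup_single when_def intro!: sum.neutral)
  qed
  have "Poly_Mapping.lookup (?b G) (omit i G) =
      (\<Sum>k\<in>{1..<length G - 1}. (if k = i then (-1) ^ (k - 1) else 0))"
    unfolding lookup_sum lookup_single
    using complete_flags_nth(1)[OF G] omit_flags_eq(1)[OF G G U i(2)]
    by (intro sum.cong) (auto simp: when_def)
  also have "\<dots> = (-1) ^ (i - 1)"
    using i complete_flags_nth(1)[OF G] by simp
  finally have b: "Poly_Mapping.lookup (?b G) (omit i G) = (-1) ^ (i - 1)" .
  have "0 = Poly_Mapping.lookup (boundary z) (omit i G)" using \<open>boundary z = 0\<close> by simp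
  also have "\<dots> = (\<Sum>G'\<in>?S. Poly_Mapping.lookup z G' * Poly_Mapping.lookup (?b G') (omit i G))"
    unfolding boundary_def by (rule lookup_lin) auto
  also have "\<dots> = Poly_Mapping.lookup z G * (-1) ^ (i - 1)"
    using sum.neutral[of "?S - {G}", OF ballI[OF zero]] b by (subst sum.remove[of _ G]) auto
  finally show ?thesis by simp
qed

text \<open>For complete flags of the same space the two dimensions add up to the dimension of that
  space, so trivial intersection means complementary: this is the usual opposition of
  chambers.\<close>

definition opposite :: "'v set list \<Rightarrow> 'v set list \<Rightarrow> bool" where
  "opposite F G \<longleftrightarrow> (\<forall>i<length F. F ! i \<inter> G ! (length F - 1 - i) = {0})"

text \<open>If \<open>G\<close> is not opposite to \<open>F\<close>, it has a panel all of whose other chambers are further away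
  from \<open>F\<close>. The nested induction makes this precise: \<open>c\<close> counts the positions, from below, at which
  nothing is known yet, and \<open>j\<close> is a position up to which \<open>G\<close> is already transversal to \<open>F ! (n - c)\<close>.\<close>

lemma cycle_eq_0_if_vanishes_on_opposites:
  assumes z: "z \<in> St U" and U: "U = span B" "finite B" and F: "F \<in> complete_flags U"
    and van: "\<And>G. G \<in> complete_flags U \<Longrightarrow> opposite F G \<Longrightarrow> Poly_Mapping.lookup z G = 0"
  shows "z = 0"
proof -
  define n where "n = dim U"
  \<comment> \<open>At c = 0 the condition on G is opposition to F; at c = n it holds for every
    chamber. The outer induction goes from the former to the latter.\<close>
  have claim: "\<forall>G\<in>complete_flags U. (\<forall>i. c \<le> i \<longrightarrow> i \<le> n \<longrightarrow> G ! i \<inter> F ! (n - i) = {0}) \<longrightarrow>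
      Poly_Mapping.lookup z G = 0" if "c \<le> n" for c
    using that
  proof (induction c)
    case 0
    have "opposite F G" if "\<forall>i\<le>n. G ! i \<inter> F ! (n - i) = {0}" for G
      unfolding opposite_def
    proof (intro allI impI)
      fix i assume "i < length F"
      then have "i \<le> n" using complete_flags_nth(1)[OF F] by (simp add: n_def)
      then show "F ! i \<inter> G ! (length F - 1 - i) = {0}"
        using that[rule_format, of "n - i"] complete_flags_nth(1)[OF F]
        by (simp add: n_def Int_commute)
    qed
    then show ?case using van by auto
  next
    case (Suc c)
    \<comment> \<open>Downward induction from j = c, where the hypotheses on G are those of the
      outer claim for c, to j = 0.\<close>
    have inner: "\<forall>G\<in>complete_flags U. (\<forall>i. Suc c \<le> i \<longrightarrow> i \<le> n \<longrightarrow> G ! i \<inter> F ! (n - i) = {0}) \<longrightarrow>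
        G ! j \<inter> F ! (n - c) = {0} \<longrightarrow> Poly_Mapping.lookup z G = 0" if "j \<le> c" for j
      using that
    proof (induction rule: inc_induct)
      case base
      then show ?case using Suc by (metis Suc_leD le_antisym not_less_eq_eq)
    next
      case (step m)
      show ?case
      proof (intro ballI impI)
        fix G assume G: "G \<in> complete_flags U"
          and above: "\<forall>i. Suc c \<le> i \<longrightarrow> i \<le> n \<longrightarrow> G ! i \<inter> F ! (n - i) = {0}"
          and m: "G ! m \<inter> F ! (n - c) = {0}"
        show "Poly_Mapping.lookup z G = 0"
        proof (cases "G ! Suc m \<inter> F ! (n - c) = {0}")
          case True
          then show ?thesis using step.IH G above by blast
        next
          case False
          have mc: "m < c" "c < n" using step Suc by auto
          have subF: "subspace (F ! (n - c))" "subspace (F ! (n - Suc c))"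
            using complete_flags_nth(4)[OF F] by (auto simp: n_def)
          have subG: "subspace (G ! Suc m)" "subspace (G ! Suc c)"
            using complete_flags_nth(4)[OF G] mc by (auto simp: n_def)
          \<comment> \<open>\<open>G ! Suc c \<inter> F ! (n - c)\<close> is the line of x, as
            \<open>F ! (n - Suc c)\<close> has codimension one in \<open>F ! (n - c)\<close> and
            meets \<open>G ! Suc c\<close> only in 0. A chamber on the panel of G at
            \<open>Suc m\<close> that meets \<open>F ! (n - c)\<close> nontrivially in that position
            contains x there, hence is G. All others fall under the induction hypothesis for
            \<open>Suc m\<close>.\<close>
          obtain x where x: "x \<in> G ! Suc m" "x \<in> F ! (n - c)" "x \<noteq> 0"
            using False subspace_0[OF subG(1)] subspace_0[OF subF(1)] by blast
          have xG: "x \<in> G ! Suc c"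
            using x complete_flags_mono[OF G, of "Suc m" "Suc c"] mc by (auto simp: n_def)
          then have "x \<notin> F ! (n - Suc c)" using above[rule_format, of "Suc c"] mc x by auto
          moreover have "n - c = Suc (n - Suc c)" using mc by simp
          ultimately have Fc: "F ! (n - c) = span (insert x (F ! (n - Suc c)))"
            using complete_flags_step[OF F U, of "n - Suc c" x] x mc by (simp add: n_def)
          show ?thesis
          proof (rule cycle_panel[OF z U G, of "Suc m"])
            fix G' assume G': "G' \<in> complete_flags U" "G' \<noteq> G"
              and agree: "\<And>j. j \<le> dim U \<Longrightarrow> j \<noteq> Suc m \<Longrightarrow> G' ! j = G ! j"
            have "y = 0" if y: "y \<in> G' ! Suc m" "y \<in> F ! (n - c)" for y
            proof (rule ccontr)
              assume "y \<noteq> 0"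
              have "y \<notin> G ! m" using y m \<open>y \<noteq> 0\<close> by auto
              have "y \<in> G ! Suc c"
                using y complete_flags_mono[OF G'(1), of "Suc m" "Suc c"] mc agree[of "Suc c"]
                by (auto simp: n_def)
              obtain k where "y - scale k x \<in> F ! (n - Suc c)"
                using y(2) span_eq_iff[THEN iffD2, OF subF(2)] unfolding Fc span_breakdown_eq by blast
              moreover have "y - scale k x \<in> G ! Suc c"
                using \<open>y \<in> G ! Suc c\<close> xG subG by (intro subspace_diff subspace_scale)
              moreover have "G ! Suc c \<inter> F ! (n - Suc c) = {0}" using above mc by simp
              ultimately have "y - scale k x = 0" by blast
              then have "y = scale k x" by simp
              then have yG: "y \<in> G ! Suc m" using x subG by (simp add: subspace_scale)
              have "G ! Suc m = span (insert y (G ! m))"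
                using mc yG \<open>y \<notin> G ! m\<close> by (intro complete_flags_step[OF G U]) (auto simp: n_def)
              moreover have "G' ! Suc m = span (insert y (G' ! m))"
                using mc y \<open>y \<notin> G ! m\<close> agree[of m]
                by (intro complete_flags_step[OF G'(1) U]) (auto simp: n_def)
              ultimately have "G' ! Suc m = G ! Suc m" using agree[of m] mc by (simp add: n_def)
              then have "G' = G"
                using complete_flags_nth(1)[OF G] complete_flags_nth(1)[OF G'(1)] agree
                by (intro nth_equalityI) (auto simp: less_Suc_eq_le)
              then show False using G' by simp
            qed
            moreover have "subspace (G' ! Suc m)"
              using complete_flags_nth(4)[OF G'(1)] mc by (auto simp: n_def)
            ultimately have "G' ! Suc m \<inter> F ! (n - c) = {0}"
              using subspace_0 subF by blast
            moreover have "\<forall>i. Suc c \<le> i \<longrightarrow> i \<le> n \<longrightarrow> G' ! i \<inter> F ! (n - i) = {0}"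
              using above agree mc by (auto simp: n_def)
            ultimately show "Poly_Mapping.lookup z G' = 0" using step.IH G'(1) by blast
          qed (use mc in \<open>auto simp: n_def\<close>)
        qed
      qed
    qed
    show ?case
    proof (intro ballI impI)
      fix G assume G: "G \<in> complete_flags U"
        and *: "\<forall>i. Suc c \<le> i \<longrightarrow> i \<le> n \<longrightarrow> G ! i \<inter> F ! (n - i) = {0}"
      \<comment> \<open>The inner induction is entered at j = 0, where \<open>G ! 0\<close> is the
        zero space.\<close>
      have "0 \<in> F ! (n - c)" using complete_flags_nth(4)[OF F, of "n - c"] subspace_0 by (auto simp: n_def)
      then have "G ! 0 \<inter> F ! (n - c) = {0}" using complete_flags_nth(2)[OF G] by auto
      then show "Poly_Mapping.lookup z G = 0" using inner[of 0] G * by blast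
    qed
  qed
  have "Poly_Mapping.lookup z G = 0" for G
  proof (cases "G \<in> complete_flags U")
    case True
    \<comment> \<open>For c = n only \<open>G ! n \<inter> F ! 0\<close> has to be trivial, and
      \<open>F ! 0\<close> is zero, so the claim applies to every chamber.\<close>
    have "0 \<in> G ! n" using complete_flags_nth(4)[OF True, of n] subspace_0 by (auto simp: n_def)
    then have "G ! n \<inter> F ! 0 = {0}" using complete_flags_nth(2)[OF F] by auto
    then show ?thesis using claim[of n] True by auto
  next
    case False
    then show ?thesis using z by (auto simp: St_def in_keys_iff)
  qed
  then show ?thesis by (intro poly_mapping_eqI) simp
qed

section \<open>Apartments\<close>

definition basis_family :: "(nat \<Rightarrow> 'v) \<Rightarrow> nat set \<Rightarrow> 'v set \<Rightarrow> bool" where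
  "basis_family v I U \<longleftrightarrow> finite I \<and> inj_on v I \<and> independent (v ` I) \<and> span (v ` I) = U"

lemma basis_family_dim: "basis_family v I U \<Longrightarrow> dim U = card I"
  unfolding basis_family_def by (auto simp: dim_eq_card_independent card_image)

lemma basis_family_notin_span:
  assumes "basis_family v I U" "i \<in> I" "T \<subseteq> I" "i \<notin> T"
  shows "v i \<notin> span (v ` T)"
proof
  assume "v i \<in> span (v ` T)"
  moreover have "v ` T \<subseteq> v ` I - {v i}"
    using assms unfolding basis_family_def inj_on_def by blast
  ultimately have "v i \<in> span (v ` I - {v i})" using span_mono by blast
  then show False using assms unfolding basis_family_def dependent_def by blast
qed

lemma basis_family_nonzero: "basis_family v I U \<Longrightarrow> i \<in> I \<Longrightarrow> v i \<noteq> 0"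
  using basis_family_notin_span[of v I U i "{}"] by auto

lemma basis_family_subset:
  "basis_family v I U \<Longrightarrow> T \<subseteq> I \<Longrightarrow> basis_family v T (span (v ` T))"
  unfolding basis_family_def
  using independent_mono[of "v ` I" "v ` T"] by (auto intro: finite_subset inj_on_subset)

definition vflag :: "(nat \<Rightarrow> 'v) \<Rightarrow> nat list \<Rightarrow> 'v set list" where
  "vflag v xs = map (\<lambda>k. span (v ` set (take k xs))) [0..<Suc (length xs)]"

lemma length_vflag [simp]: "length (vflag v xs) = Suc (length xs)"
  by (simp add: vflag_def)

lemma nth_vflag [simp]: "k \<le> length xs \<Longrightarrow> vflag v xs ! k = span (v ` set (take k xs))"
  by (simp add: vflag_def nth_append)

lemma span_Union_lines: "span (\<Union>i\<in>X. span {v i}) = span (v ` X)"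
proof -
  have "span {v i} \<subseteq> span (v ` X)" if "i \<in> X" for i using that by (intro span_mono) auto
  moreover have "v i \<in> span {v i}" for i by (rule span_base) simp
  then have "v ` X \<subseteq> (\<Union>i\<in>X. span {v i})" by blast
  ultimately show ?thesis
    by (intro subset_antisym span_minimal[OF _ subspace_span] span_mono) auto
qed

lemma flag_of_lines_vflag: "flag_of_lines (map (\<lambda>i. span {v i}) xs) = vflag v xs"
  by (auto simp: flag_of_lines_def vflag_def take_map span_Union_lines simp del: upt_Suc)

lemma span_take_psubset:
  assumes "basis_family v I U" "distinct xs" "set xs \<subseteq> I" "k < l" "l \<le> length xs"
  shows "span (v ` set (take k xs)) \<subset> span (v ` set (take l xs))"
proof -
  have "xs ! k \<in> set (take l xs)" using assms by (auto simp: in_set_conv_nth intro!: exI[of _ k])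
  then have "v (xs ! k) \<in> span (v ` set (take l xs))" by (intro span_base) auto
  moreover have "xs ! k \<notin> set (take k xs)"
    using assms by (auto simp: in_set_conv_nth nth_eq_iff_index_eq)
  then have "v (xs ! k) \<notin> span (v ` set (take k xs))"
    using assms set_take_subset[of k xs] by (intro basis_family_notin_span[OF assms(1)]) auto
  moreover have "span (v ` set (take k xs)) \<subseteq> span (v ` set (take l xs))"
    using assms by (intro span_mono image_mono set_take_subset_set_take) auto
  ultimately show ?thesis by blast
qed

lemma vflag_complete:
  assumes v: "basis_family v I U" and xs: "xs \<in> permutations_of_set I"
  shows "vflag v xs \<in> complete_flags U"
proof -
  note p = permutations_of_setE[OF xs]
  have "length (vflag v xs) = Suc (dim U)" using basis_family_dim[OF v] p by simp
  moreover have ne: "vflag v xs \<noteq> []" by (simp add: vflag_def)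
  have "hd (vflag v xs) = {0}" by (simp add: hd_conv_nth[OF ne])
  moreover have "last (vflag v xs) = U"
    using v p by (simp add: last_conv_nth[OF ne] basis_family_def)
  moreover have "\<forall>X\<in>set (vflag v xs). subspace X" by (auto simp: vflag_def)
  moreover have "sorted_wrt (\<subset>) (vflag v xs)"
    using span_take_psubset[OF v, of xs] p by (auto simp: sorted_wrt_iff_nth_less less_Suc_eq_le)
  ultimately show ?thesis by (simp add: complete_flags_def)
qed

text \<open>The apartment class written over orderings of the index set instead of permutations of
  positions.\<close>

definition apt :: "(nat \<Rightarrow> 'v) \<Rightarrow> nat set \<Rightarrow> ('v set list \<Rightarrow>\<^sub>0 rat)" where
  "apt v I = (\<Sum>xs\<in>permutations_of_set I. Poly_Mapping.single (vflag v xs) (of_int (isgn xs)))"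

text \<open>Because the index list is increasing, the sign of a permutation of positions is the
  inversion sign of the resulting list of indices. The subspaces \<open>L i\<close> stay
  arbitrary.\<close>

lemma apartment_sorted:
  assumes "finite K"
  shows "apartment (map L (sorted_list_of_set K)) =
    (\<Sum>xs\<in>permutations_of_set K. Poly_Mapping.single (flag_of_lines (map L xs)) (of_int (isgn xs)))"
proof -
  let ?s = "sorted_list_of_set K"
  have sgn: "isgn (permute_list \<sigma> ?s) = sign \<sigma>" if "\<sigma> permutes {..<length ?s}" for \<sigma>
  proof -
    have "permute_list \<sigma> ?s = map ((!) ?s) (map \<sigma> [0..<length ?s])"
      by (simp add: permute_list_def)
    moreover have "set (map \<sigma> [0..<length ?s]) = {..<length ?s}"
      using permutes_image[OF that] by (simp add: atLeast0LessThan)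
    moreover have "strict_mono_on {..<length ?s} ((!) ?s)"
      using sorted_wrt_nth_less[OF strict_sorted_list_of_set[of K]] by (auto simp: strict_mono_on_def)
    ultimately have "isgn (permute_list \<sigma> ?s) = isgn (map \<sigma> [0..<length ?s])"
      by (simp only: isgn_map_strict_mono_on)
    also have "\<dots> = sign \<sigma>"
      using that by (subst isgn_map_permutes) (auto simp: atLeast0LessThan isgn_sorted)
    finally show ?thesis .
  qed
  have "apartment (map L ?s) = (\<Sum>\<sigma> | \<sigma> permutes {..<length ?s}.
      Poly_Mapping.single (flag_of_lines (map L (permute_list \<sigma> ?s))) (of_int (isgn (permute_list \<sigma> ?s))))"
    unfolding apartment_def by (intro sum.cong) (auto simp: sgn permute_list_map)
  also have "\<dots> = (\<Sum>xs\<in>permutations_of_set (set ?s).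
      Poly_Mapping.single (flag_of_lines (map L xs)) (of_int (isgn xs)))"
    by (rule sum.reindex_bij_betw[OF bij_betw_permutes_permutations_of_set]) simp
  finally show ?thesis using assms by simp
qed

lemma apartment_apt:
  "finite K \<Longrightarrow> apartment (map (\<lambda>i. span {v i}) (sorted_list_of_set K)) = apt v K"
  by (simp add: apartment_sorted apt_def flag_of_lines_vflag)

lemma vec_apartment_apt:
  "finite K \<Longrightarrow> vec_apartment (map v (sorted_list_of_set K)) = apt v K"
  unfolding vec_apartment_def by (simp add: comp_def apartment_apt)

lemma keys_apt: "Poly_Mapping.keys (apt v I) \<subseteq> vflag v ` permutations_of_set I"
  unfolding apt_def by (rule keys_sum_single)

text \<open>Exchanging the entries \<open>i - 1\<close> and \<open>i\<close> of an ordering changes its sign but only the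
  \<open>i\<close>-th entry of its flag.\<close>

lemma sum_omit_vflag_eq_0:
  assumes "0 < i" "i < card I" "finite I"
  shows "(\<Sum>xs\<in>permutations_of_set I. Poly_Mapping.single (omit i (vflag v xs)) (c * of_int (isgn xs))) =
    (0 :: 'v set list \<Rightarrow>\<^sub>0 rat)"
proof -
  define \<phi> :: "nat list \<Rightarrow> nat list" where "\<phi> xs = xs[i - 1 := xs ! i, i := xs ! (i - 1)]" for xs
  let ?g = "\<lambda>xs. Poly_Mapping.single (omit i (vflag v xs)) (c * of_int (isgn xs)) :: 'v set list \<Rightarrow>\<^sub>0 rat"
  have len: "length xs = card I" if "xs \<in> permutations_of_set I" for xs
    using permutations_of_setE[OF that] by simp
  have in_perm: "\<phi> xs \<in> permutations_of_set I" if "xs \<in> permutations_of_set I" for xs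
    using that len[OF that] assms unfolding \<phi>_def permutations_of_set_def
    by (simp add: set_swap distinct_swap)
  have inv: "\<phi> (\<phi> xs) = xs" if "xs \<in> permutations_of_set I" for xs
    using assms len[OF that] by (intro nth_equalityI) (simp_all add: \<phi>_def nth_list_update)
  have g: "?g (\<phi> xs) = - ?g xs" if xs: "xs \<in> permutations_of_set I" for xs
  proof -
    obtain as a b cs where split: "xs = as @ a # b # cs" "length as = i - 1"
    proof
      show "xs = take (i - 1) xs @ xs ! (i - 1) # xs ! i # drop (Suc i) xs"
        using assms len[OF xs] id_take_nth_drop[of "i - 1" xs] Cons_nth_drop_Suc[of i xs] by simp
    qed (use assms len[OF xs] in simp)
    have "\<phi> xs = as @ b # a # cs"
      using assms split by (cases i) (simp_all add: \<phi>_def nth_append list_update_append)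
    then have "isgn (\<phi> xs) = - isgn xs"
      using isgn_swap[of as a "[]" b cs] split permutations_of_setE(2)[OF xs] by simp
    moreover have "set (take k (\<phi> xs)) = set (take k xs)" if "k \<noteq> i" for k
    proof (cases "k < i")
      case True
      then show ?thesis by (simp add: \<phi>_def)
    next
      case False
      then have "k > i" using that by simp
      then have "take k (\<phi> xs) = (take k xs)[i - 1 := take k xs ! i, i := take k xs ! (i - 1)]"
        by (simp add: \<phi>_def take_update_swap)
      also have "set \<dots> = set (take k xs)"
        using \<open>k > i\<close> assms len[OF xs] by (intro set_swap) auto
      finally show ?thesis .
    qed
    then have "omit i (vflag v (\<phi> xs)) = omit i (vflag v xs)"
      using assms len[OF xs] len[OF in_perm[OF xs]]
      by (auto simp: list_eq_iff_nth_eq length_omit nth_omit)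
    ultimately show ?thesis by (simp add: single_uminus)
  qed
  \<comment> \<open>\<open>\<phi>\<close> is a sign-reversing involution of the orderings, so the
    sum equals its own negative and vanishes over the rationals.\<close>
  have "sum ?g (permutations_of_set I) = sum (\<lambda>xs. ?g (\<phi> xs)) (permutations_of_set I)"
    by (rule sum.reindex_bij_witness[of _ \<phi> \<phi>]) (auto simp: in_perm inv)
  also have "\<dots> = - sum ?g (permutations_of_set I)"
    by (simp add: g sum_negf)
  finally have "Poly_Mapping.lookup (sum ?g (permutations_of_set I)) a =
      - Poly_Mapping.lookup (sum ?g (permutations_of_set I)) a" for a
    by (rule ssubst[where P = "\<lambda>u. _ = - Poly_Mapping.lookup u a"]) simp
  then show ?thesis by (intro poly_mapping_eqI) simp
qed

lemma apt_St:
  assumes v: "basis_family v I U"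
  shows "apt v I \<in> St U"
proof -
  have fin: "finite I" using v by (simp add: basis_family_def)
  have "boundary (apt v I) = (\<Sum>xs\<in>permutations_of_set I. \<Sum>i\<in>{1..<card I}.
      Poly_Mapping.single (omit i (vflag v xs)) ((-1) ^ (i - 1) * of_int (isgn xs)))"
    unfolding apt_def flinear_sum[OF flinear_boundary]
    by (intro sum.cong refl)
      (auto simp: boundary_def lin_single free.scale_sum_right fscale_single mult.commute permutations_of_setE(3))
  also have "\<dots> = (\<Sum>i\<in>{1..<card I}. \<Sum>xs\<in>permutations_of_set I.
      Poly_Mapping.single (omit i (vflag v xs)) ((-1) ^ (i - 1) * of_int (isgn xs)))"
    by (rule sum.swap)
  also have "\<dots> = 0" using fin by (intro sum.neutral ballI sum_omit_vflag_eq_0) auto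
  finally show ?thesis
    using keys_apt[of v I] vflag_complete[OF v] by (auto simp: St_def)
qed

text \<open>If the chamber of \<open>xs\<close> is opposite to the standard one, the nonzero vector
  \<open>p (xs ! m)\<close> of its entry \<open>Suc m\<close> cannot lie in the span of the first n
  - (m + 1) basis vectors. This bounds \<open>xs ! m\<close> from below and forces the reversed
  ordering.\<close>

lemma lookup_apt_opposite:
  assumes p: "basis_family p {..<n} U" and G: "opposite (vflag p [0..<n]) G"
  shows "Poly_Mapping.lookup (apt p {..<n}) G =
    (if vflag p (rev [0..<n]) = G then of_int (isgn (rev [0..<n])) else 0)"
proof -
  have eq: "xs = rev [0..<n]" if xs: "xs \<in> permutations_of_set {..<n}" and "vflag p xs = G" for xs
  proof (rule eq_rev_upt[OF xs])
    fix m assume m: "m < n"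
    note px = permutations_of_setE[OF xs]
    show "n - Suc m \<le> xs ! m"
    proof (rule ccontr)
      assume lt: "\<not> n - Suc m \<le> xs ! m"
      let ?k = "n - Suc m"
      have "xs ! m \<in> {..<n}" using px m nth_mem[of m xs] by auto
      have "xs ! m \<in> set (take ?k [0..<n])" using lt m by simp
      then have "p (xs ! m) \<in> span (p ` set (take ?k [0..<n]))" by (rule span_base[OF imageI])
      then have 1: "p (xs ! m) \<in> vflag p [0..<n] ! ?k" by (subst nth_vflag) simp_all
      have "xs ! m \<in> set (take (Suc m) xs)"
        using m px(3) take_Suc_conv_app_nth[of m xs] by simp
      then have "p (xs ! m) \<in> span (p ` set (take (Suc m) xs))" by (rule span_base[OF imageI])
      then have 2: "p (xs ! m) \<in> G ! Suc m"
        unfolding that(2)[symmetric] by (subst nth_vflag) (use m px(3) in simp_all)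
      have "vflag p [0..<n] ! ?k \<inter> G ! Suc m = {0}"
        using G[unfolded opposite_def, rule_format, of ?k] m by simp
      then have "p (xs ! m) = 0" using 1 2 by blast
      then show False using basis_family_nonzero[OF p \<open>xs ! m \<in> {..<n}\<close>] by simp
    qed
  qed
  have mem: "rev [0..<n] \<in> permutations_of_set {..<n}"
    by (auto simp: permutations_of_set_def)
  have "Poly_Mapping.lookup (apt p {..<n}) G =
      (\<Sum>xs\<in>permutations_of_set {..<n}. if xs = rev [0..<n] then
        (if vflag p (rev [0..<n]) = G then of_int (isgn (rev [0..<n])) else 0) else 0)"
    unfolding apt_def lookup_sum lookup_single
  proof (rule sum.cong[OF refl])
    fix xs assume xs: "xs \<in> permutations_of_set {..<n}"
    show "(of_int (isgn xs) when vflag p xs = G) = (if xs = rev [0..<n] then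
        (if vflag p (rev [0..<n]) = G then of_int (isgn (rev [0..<n])) else 0) else 0 :: rat)"
    proof (cases "xs = rev [0..<n]")
      case False
      then show ?thesis using eq[OF xs] by (cases "vflag p xs = G") simp_all
    qed simp
  qed
  then show ?thesis using mem by simp
qed

section \<open>The bar complex\<close>

lemma basis_family_disjoint_Int:
  assumes v: "basis_family v I U" and ST: "S \<subseteq> I" "T \<subseteq> I" "S \<inter> T = {}"
  shows "span (v ` S) \<inter> span (v ` T) = {0}"
proof -
  have "finite T" using v ST by (auto simp: basis_family_def intro: finite_subset)
  then have "span (v ` S) \<inter> span (v ` T) \<subseteq> {0}" using ST
  proof (induction T)
    case (insert i T)
    show ?case
    proof
      fix x assume x: "x \<in> span (v ` S) \<inter> span (v ` insert i T)"
      then obtain k where k: "x - scale k (v i) \<in> span (v ` T)"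
        by (auto simp: span_breakdown_eq)
      show "x \<in> {0}"
      proof (cases "k = 0")
        case True
        then show ?thesis using k x insert by auto
      next
        case False
        have "v ` S \<subseteq> v ` (S \<union> T)" "v ` T \<subseteq> v ` (S \<union> T)" by auto
        then have "x \<in> span (v ` (S \<union> T))" "x - scale k (v i) \<in> span (v ` (S \<union> T))"
          using x k span_mono by blast+
        then have "x - (x - scale k (v i)) \<in> span (v ` (S \<union> T))" by (rule span_diff)
        then have "scale k (v i) \<in> span (v ` (S \<union> T))" by simp
        then have "scale (inverse k) (scale k (v i)) \<in> span (v ` (S \<union> T))"
          by (rule span_scale)
        then have "scale (inverse k * k) (v i) \<in> span (v ` (S \<union> T))"
          by (simp only: scale_scale)
        then have "v i \<in> span (v ` (S \<union> T))" using False by simp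
        moreover have "v i \<notin> span (v ` (S \<union> T))"
          using insert by (intro basis_family_notin_span[OF v]) auto
        ultimately show ?thesis by simp
      qed
    qed
  qed simp
  then show ?thesis using span_zero by blast
qed

text \<open>Opposition of the flag of \<open>xs\<close> and the flag of \<open>rev ys\<close>,
  indexed by the cut k of both lists.\<close>

definition transversal :: "(nat \<Rightarrow> 'v) \<Rightarrow> (nat \<Rightarrow> 'v) \<Rightarrow> nat list \<Rightarrow> nat list \<Rightarrow> bool" where
  "transversal v w xs ys \<longleftrightarrow>
    (\<forall>k\<le>length xs. span (v ` set (take k xs)) \<inter> span (w ` set (drop k ys)) = {0})"

text \<open>For transversal orderings of bases of one n-dimensional space the two subspaces have
  dimensions k + 1 and n - k, hence meet in a line. These lines form the frame common to the two
  opposite flags.\<close>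

definition lines_between :: "(nat \<Rightarrow> 'v) \<Rightarrow> (nat \<Rightarrow> 'v) \<Rightarrow> nat list \<Rightarrow> nat list \<Rightarrow> 'v set list" where
  "lines_between v w xs ys =
    map (\<lambda>k. span (v ` set (take (Suc k) xs)) \<inter> span (w ` set (drop k ys))) [0..<length xs]"

text \<open>An adapted basis of two opposite flags: its initial segments span the first flag and its
  final segments the second.\<close>

lemma lines_between_family:
  assumes v: "basis_family v I U" and w: "basis_family w J U"
    and xs: "xs \<in> permutations_of_set I" and ys: "ys \<in> permutations_of_set J"
    and tr: "transversal v w xs ys"
  obtains p where "basis_family p {..<dim U} U"
    "lines_between v w xs ys = map (\<lambda>i. span {p i}) [0..<dim U]"
    "vflag p [0..<dim U] = vflag v xs" "vflag p (rev [0..<dim U]) = vflag w (rev ys)"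
proof -
  define n where "n = dim U"
  define S where "S k = span (v ` set (take k xs))" for k
  define T where "T k = span (w ` set (drop k ys))" for k
  note px = permutations_of_setE[OF xs] and py = permutations_of_setE[OF ys]
  have len: "length xs = n" "length ys = n"
    using px py basis_family_dim[OF v] basis_family_dim[OF w] by (auto simp: n_def)
  have ST: "S k \<inter> T k = {0}" if "k \<le> n" for k
    using tr that len by (simp add: transversal_def S_def T_def)
  have sumU: "span (v ` set (take k xs) \<union> w ` set (drop k ys)) = U" if "k \<le> n" for k
  proof (rule span_Un_direct_eq[of _ "v ` I"])
    have I: "set (take k xs) \<subseteq> I" "set (drop k ys) \<subseteq> J"
      using px py set_take_subset[of k xs] set_drop_subset[of k ys] by auto
    note b = basis_family_subset[OF v I(1)] basis_family_subset[OF w I(2)]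
    then show "independent (v ` set (take k xs))" "independent (w ` set (drop k ys))"
      by (auto simp: basis_family_def)
    show "v ` set (take k xs) \<subseteq> U" "w ` set (drop k ys) \<subseteq> U"
      using v w I span_superset unfolding basis_family_def by blast+
    have "card (v ` set (take k xs)) = k" "card (w ` set (drop k ys)) = n - k"
      using b len that px py by (auto simp: basis_family_def card_image distinct_card)
    then show "card (v ` set (take k xs)) + card (w ` set (drop k ys)) = dim U"
      using that by (simp add: n_def)
    show "span (v ` set (take k xs)) \<inter> span (w ` set (drop k ys)) = {0}"
      using ST[OF that] by (simp add: S_def T_def)
  qed (use v in \<open>auto simp: basis_family_def\<close>)
  \<comment> \<open>What makes p the k-th adapted vector: it extends S k to S (k + 1), extends T (k
    + 1) to T k, and spans their common line.\<close>
  let ?P = "\<lambda>k p. S (Suc k) = span (insert p (v ` set (take k xs))) \<and> p \<notin> S k \<and>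
      T k = span (insert p (w ` set (drop (Suc k) ys))) \<and> S (Suc k) \<inter> T k = span {p}"
  have ex: "\<exists>p. ?P k p" if k: "k < n" for k
  proof -
    have Sk: "S (Suc k) = span (insert (v (xs ! k)) (v ` set (take k xs)))"
      using k len by (simp add: S_def take_Suc_conv_app_nth)
    have Tk: "T k = span (insert (w (ys ! k)) (w ` set (drop (Suc k) ys)))"
      using k len by (simp add: T_def flip: Cons_nth_drop_Suc)
    have notin: "v (xs ! k) \<notin> S k"
      unfolding S_def using k len px set_take_subset[of k xs]
      by (intro basis_family_notin_span[OF v]) (auto simp: in_set_conv_nth nth_eq_iff_index_eq)
    have "v (xs ! k) \<in> U"
      using v px len k unfolding basis_family_def by (metis imageI nth_mem span_base)
    then have "v (xs ! k) \<in> span (v ` set (take k xs) \<union> w ` set (drop k ys))"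
      using sumU[of k] k by simp
    \<comment> \<open>The witness is the component of the k-th vector of \<open>v\<close> in T k
      along S k.\<close>
    then obtain s p where sp: "v (xs ! k) = s + p" "s \<in> S k" "p \<in> T k"
      unfolding span_Un S_def T_def by blast
    have S1: "S (Suc k) = span (insert p (v ` set (take k xs)))"
      unfolding Sk using sp by (intro eq_span_insert_eq) (simp add: S_def)
    have p1: "p \<notin> S k"
      using notin sp span_add[of s "v ` set (take k xs)" p] by (auto simp: S_def)
    have pS: "p \<in> S (Suc k)" unfolding S1 by (rule span_base) simp
    have "p \<notin> T (Suc k)"
    proof
      assume "p \<in> T (Suc k)"
      then have "p = 0" using ST[of "Suc k"] pS k by (metis IntI Suc_leI singletonD)
      then show False using p1 span_zero by (simp add: S_def)
    qed
    \<comment> \<open>Exchange: p lies in T k but not in T (k + 1), so it can replace the vector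
      \<open>w (ys ! k)\<close>.\<close>
    let ?X = "w ` set (drop (Suc k) ys)"
    have "p \<in> span (insert (w (ys ! k)) ?X)" using sp(3) unfolding Tk .
    moreover from this have "w (ys ! k) \<in> span (insert p ?X)"
      using \<open>p \<notin> T (Suc k)\<close> unfolding T_def by (rule in_span_insert)
    ultimately have "insert p ?X \<subseteq> span (insert (w (ys ! k)) ?X)"
      "insert (w (ys ! k)) ?X \<subseteq> span (insert p ?X)"
      using span_superset[of "insert (w (ys ! k)) ?X"] span_superset[of "insert p ?X"] by blast+
    then have T1: "T k = span (insert p ?X)" unfolding Tk span_eq by simp
    have "S (Suc k) \<inter> T k \<subseteq> span {p}"
    proof
      fix q assume q: "q \<in> S (Suc k) \<inter> T k"
      then have "q \<in> span (insert p (v ` set (take k xs)))" using S1 by simp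
      then obtain c where "q - scale c p \<in> S k"
        unfolding span_breakdown_eq S_def by blast
      moreover have "q - scale c p \<in> T k"
        using q sp(3) unfolding T_def by (intro span_diff span_scale) auto
      ultimately have "q - scale c p \<in> S k \<inter> T k" by (rule IntI)
      then have "q - scale c p = 0" using ST[of k] k by simp
      then show "q \<in> span {p}" by (auto simp: span_singleton)
    qed
    moreover have "span {p} \<subseteq> S (Suc k) \<inter> T k"
      using pS sp(3) by (intro span_minimal) (auto simp: S_def T_def intro: subspace_inter)
    ultimately show ?thesis using S1 T1 p1 by blast
  qed
  then have "\<forall>k\<in>{..<n}. \<exists>p. ?P k p" by blast
  from bchoice[OF this] obtain p where p: "\<And>k. k < n \<Longrightarrow> ?P k (p k)" by blast
  have pS: "span (p ` {..<k}) = S k" if "k \<le> n" for k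
    using that
  proof (induction k)
    case (Suc k)
    then have "span (p ` {..<Suc k}) = span (insert (p k) (v ` set (take k xs)))"
      unfolding lessThan_Suc image_insert by (intro span_insert_cong) (simp add: S_def)
    then show ?case using p[of k] Suc by simp
  qed (simp add: S_def)
  have pT: "span (p ` {k..<n}) = T k" if "k \<le> n" for k
    using that
  proof (induction rule: inc_induct)
    case (step m)
    have "{m..<n} = insert m {Suc m..<n}" using step by auto
    then have "span (p ` {m..<n}) = span (insert (p m) (w ` set (drop (Suc m) ys)))"
      using step by (simp only: image_insert, intro span_insert_cong) (simp add: T_def)
    then show ?case using p[of m] step by simp
  qed (simp add: T_def len)
  have ind: "independent (p ` {..<k}) \<and> inj_on p {..<k}" if "k \<le> n" for k
    using that
  proof (induction k)
    case (Suc k)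
    have "p k \<notin> span (p ` {..<k})" using pS[of k] p[of k] Suc by simp
    moreover from this have "p k \<notin> p ` {..<k}" using span_base[of "p k" "p ` {..<k}"] by auto
    ultimately show ?case
      using Suc independent_insertI[of "p k" "p ` {..<k}"] by (simp add: lessThan_Suc)
  qed (simp add: independent_empty)
  have "S n = U" using v px len by (simp add: S_def basis_family_def)
  then have "basis_family p {..<n} U"
    using ind[of n] pS[of n] by (simp add: basis_family_def)
  moreover have "lines_between v w xs ys = map (\<lambda>i. span {p i}) [0..<n]"
    unfolding lines_between_def len S_def[symmetric] T_def[symmetric]
  proof (rule map_cong[OF refl])
    fix k assume "k \<in> set [0..<n]"
    then have "k < n" by simp
    from p[OF this] show "S (Suc k) \<inter> T k = span {p k}" by blast
  qed
  moreover have "vflag p [0..<n] = vflag v xs"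
    using pS len by (intro nth_equalityI) (simp_all add: S_def atLeast0LessThan)
  moreover have "vflag p (rev [0..<n]) = vflag w (rev ys)"
    using pT len by (intro nth_equalityI) (simp_all add: T_def take_rev)
  ultimately show thesis using that unfolding n_def by blast
qed

lemma transversal_opposite:
  assumes "length xs = length ys"
  shows "transversal v w xs ys \<longleftrightarrow> opposite (vflag v xs) (vflag w (rev ys))"
  using assms by (simp add: transversal_def opposite_def less_Suc_eq_le take_rev)

lemma subspace_St: "free.subspace (St U)"
  unfolding free.subspace_def St_def
proof (intro conjI allI ballI)
  fix c :: rat and x y :: "'v set list \<Rightarrow>\<^sub>0 rat"
  assume x: "x \<in> {x. Poly_Mapping.keys x \<subseteq> complete_flags U \<and> boundary x = 0}"
  then have "boundary (fscale c x) = 0" by (simp add: flinear_scale[OF flinear_boundary])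
  moreover have "Poly_Mapping.keys (fscale c x) \<subseteq> Poly_Mapping.keys x"
    by (auto simp: in_keys_iff lookup_fscale)
  ultimately show "fscale c x \<in> {x. Poly_Mapping.keys x \<subseteq> complete_flags U \<and> boundary x = 0}"
    using x by auto
  assume y: "y \<in> {x. Poly_Mapping.keys x \<subseteq> complete_flags U \<and> boundary x = 0}"
  then have "boundary (x + y) = 0"
    using x by (simp add: flinear_add[OF flinear_boundary])
  then show "x + y \<in> {x. Poly_Mapping.keys x \<subseteq> complete_flags U \<and> boundary x = 0}"
    using x y keys_add[of x y] by auto
qed (simp add: flinear_zero[OF flinear_boundary])

lemma apartment_family: "apartment (map (\<lambda>i. span {p i}) [0..<n]) = apt p {..<n}"
  using apartment_apt[of "{..<n}" p] by (simp add: lessThan_atLeast0)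

lemma transversal_apartment_sum:
  assumes v: "basis_family v I U" and w: "basis_family w J U" and xs: "xs \<in> permutations_of_set I"
  shows "(\<Sum>ys\<in>permutations_of_set J. if transversal v w xs ys
      then fscale (of_int (isgn ys)) (apartment (lines_between v w xs ys)) else 0) = apt w J"
    (is "?L = _")
proof -
  define n where "n = dim U"
  have len: "length xs = n" using permutations_of_setE[OF xs] basis_family_dim[OF v] by (simp add: n_def)
  have "?L - apt w J = 0"
  proof (rule cycle_eq_0_if_vanishes_on_opposites)
    show "?L - apt w J \<in> St U"
    proof (intro free.subspace_diff free.subspace_sum subspace_St)
      fix ys assume ys: "ys \<in> permutations_of_set J"
      show "(if transversal v w xs ys
          then fscale (of_int (isgn ys)) (apartment (lines_between v w xs ys)) else 0) \<in> St U"
      proof (cases "transversal v w xs ys")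
        case True
        from lines_between_family[OF v w xs ys True] obtain p where p: "basis_family p {..<n} U"
          "lines_between v w xs ys = map (\<lambda>i. span {p i}) [0..<n]"
          unfolding n_def by blast
        show ?thesis
          using True apt_St[OF p(1)] free.subspace_scale[OF subspace_St] by (simp add: p apartment_family)
      qed (simp add: free.subspace_0[OF subspace_St])
    qed (rule apt_St[OF w])
    show "U = span (v ` I)" "finite (v ` I)" using v by (auto simp: basis_family_def)
    show "vflag v xs \<in> complete_flags U" by (rule vflag_complete[OF v xs])
    fix G assume G: "opposite (vflag v xs) G"
    \<comment> \<open>Among chambers opposite to the flag of \<open>xs\<close>, the summand for
      \<open>ys\<close> sees only the chamber \<open>vflag w (rev ys)\<close> of B. Without
      transversality that chamber is not opposite, and both sides vanish.\<close>
    have summand: "Poly_Mapping.lookup (if transversal v w xs ys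
          then fscale (of_int (isgn ys)) (apartment (lines_between v w xs ys)) else 0) G =
        (of_int (isgn (rev ys)) when vflag w (rev ys) = G)" if ys: "ys \<in> permutations_of_set J" for ys
    proof -
      note py = permutations_of_setE[OF ys]
      have len': "length ys = n" using py basis_family_dim[OF w] by (simp add: n_def)
      show ?thesis
      proof (cases "transversal v w xs ys")
        case True
        from lines_between_family[OF v w xs ys True] obtain p where p: "basis_family p {..<n} U"
          "lines_between v w xs ys = map (\<lambda>i. span {p i}) [0..<n]"
          "vflag p [0..<n] = vflag v xs" "vflag p (rev [0..<n]) = vflag w (rev ys)"
          unfolding n_def by blast
        \<comment> \<open>Both reversals have length n, hence the same sign (-1)^(n choose 2); the
          coefficient \<open>isgn ys\<close> is left without a correction.\<close>
        have "isgn (rev ys) = isgn ys * isgn (rev [0..<n])"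
          using len' py by (simp add: isgn_rev isgn_sorted)
        then show ?thesis
          using True lookup_apt_opposite[OF p(1), of G] G p
          by (simp add: apartment_family lookup_fscale when_def)
      next
        case False
        then have "vflag w (rev ys) \<noteq> G" using G transversal_opposite len len' by auto
        with False show ?thesis by simp
      qed
    qed
    have "Poly_Mapping.lookup ?L G =
        (\<Sum>ys\<in>permutations_of_set J. of_int (isgn (rev ys)) when vflag w (rev ys) = G)"
      unfolding lookup_sum by (intro sum.cong refl summand)
    also have "\<dots> = (\<Sum>ys\<in>permutations_of_set J. of_int (isgn ys) when vflag w ys = G)"
      by (rule sum.reindex_bij_witness[of _ rev rev]) (auto simp: permutations_of_set_def)
    also have "\<dots> = Poly_Mapping.lookup (apt w J) G"
      by (simp add: apt_def lookup_sum lookup_single)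
    finally show "Poly_Mapping.lookup (?L - apt w J) G = 0" by (simp add: lookup_minus)
  qed
  then show ?thesis by simp
qed

section \<open>The preimage of a tensor of apartments under \<open>beta\<close>\<close>

lemma flinear_beta: "flinear beta"
  unfolding beta_def by (rule flinear_lin)

lemma beta_single:
  "beta (Poly_Mapping.single Ps c) = Poly_Mapping.single (flag_of_lines Ps) c \<otimes> apartment Ps"
  by (simp add: beta_def lin_single fscale_single flip: tensor_fscale_left)

text \<open>The bar element of \<open>apt v I \<otimes> apt w J\<close>: each flag of the first
  apartment is paired with the apartments through it into which the second one decomposes.\<close>

definition bar_elt :: "(nat \<Rightarrow> 'v) \<Rightarrow> nat set \<Rightarrow> (nat \<Rightarrow> 'v) \<Rightarrow> nat set \<Rightarrow> ('v set list \<Rightarrow>\<^sub>0 rat)" where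
  "bar_elt v I w J = (\<Sum>xs\<in>permutations_of_set I. \<Sum>ys\<in>permutations_of_set J.
    if transversal v w xs ys
    then Poly_Mapping.single (lines_between v w xs ys) (of_int (isgn xs * isgn ys)) else 0)"

lemma beta_bar_elt:
  assumes v: "basis_family v I U" and w: "basis_family w J U"
  shows "beta (bar_elt v I w J) = apt v I \<otimes> apt w J"
proof -
  have summand: "beta (if transversal v w xs ys
      then Poly_Mapping.single (lines_between v w xs ys) (of_int (isgn xs * isgn ys)) else 0) =
    Poly_Mapping.single (vflag v xs) (of_int (isgn xs)) \<otimes> (if transversal v w xs ys
      then fscale (of_int (isgn ys)) (apartment (lines_between v w xs ys)) else 0)"
    if xs: "xs \<in> permutations_of_set I" and ys: "ys \<in> permutations_of_set J" for xs ys
  proof (cases "transversal v w xs ys")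
    case True
    \<comment> \<open>The lines for \<open>xs\<close> and \<open>ys\<close> generate the flag of
      \<open>xs\<close> whatever \<open>ys\<close> is, so the first tensor factor can be taken out
      of the sum over \<open>ys\<close>.\<close>
    from lines_between_family[OF v w xs ys True] have "flag_of_lines (lines_between v w xs ys) = vflag v xs"
      using flag_of_lines_vflag by metis
    then show ?thesis using True
      by (simp add: beta_single tensor_fscale_right fscale_single mult.commute flip: tensor_fscale_left)
  qed (simp add: flinear_zero[OF flinear_beta] tensor_zero_right)
  have "beta (bar_elt v I w J) = (\<Sum>xs\<in>permutations_of_set I. \<Sum>ys\<in>permutations_of_set J.
    Poly_Mapping.single (vflag v xs) (of_int (isgn xs)) \<otimes> (if transversal v w xs ys
      then fscale (of_int (isgn ys)) (apartment (lines_between v w xs ys)) else 0))"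
    unfolding bar_elt_def flinear_sum[OF flinear_beta] by (intro sum.cong refl summand)
  also have "\<dots> = (\<Sum>xs\<in>permutations_of_set I.
      Poly_Mapping.single (vflag v xs) (of_int (isgn xs)) \<otimes> apt w J)"
    by (intro sum.cong refl) (simp add: transversal_apartment_sum[OF v w] flip: tensor_sum_right)
  also have "\<dots> = apt v I \<otimes> apt w J" by (simp add: apt_def flip: tensor_sum_left)
  finally show ?thesis .
qed

section \<open>Injectivity of \<open>beta\<close>\<close>

lemma line_decomps_family:
  "Ps \<in> line_decomps U \<longleftrightarrow>
    (\<exists>p. basis_family p {..<dim U} U \<and> Ps = map (\<lambda>i. span {p i}) [0..<dim U])"
proof
  assume "Ps \<in> line_decomps U"
  then obtain vs where vs: "Ps = map (\<lambda>v. span {v}) vs" "distinct vs" "independent (set vs)" "span (set vs) = U"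
    by (auto simp: line_decomps_def is_basis_list_def)
  have "dim U = length vs" using vs dim_span_eq_card_independent by (auto simp: distinct_card)
  moreover have "(!) vs ` {..<length vs} = set vs" by (auto simp: set_conv_nth)
  moreover have "inj_on ((!) vs) {..<length vs}" using vs by (simp add: inj_on_nth)
  ultimately show "\<exists>p. basis_family p {..<dim U} U \<and> Ps = map (\<lambda>i. span {p i}) [0..<dim U]"
    using vs by (intro exI[of _ "(!) vs"])
      (auto simp: basis_family_def intro!: nth_equalityI)
next
  assume "\<exists>p. basis_family p {..<dim U} U \<and> Ps = map (\<lambda>i. span {p i}) [0..<dim U]"
  then obtain p where "basis_family p {..<dim U} U" "Ps = map (\<lambda>v. span {v}) (map p [0..<dim U])" by auto
  then show "Ps \<in> line_decomps U"
    unfolding line_decomps_def is_basis_list_def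
    by (intro CollectI exI[of _ "map p [0..<dim U]"] conjI)
      (simp_all add: basis_family_def distinct_map atLeast0LessThan)
qed

lemma bar_elt_bar:
  assumes v: "basis_family v I U" and w: "basis_family w J U"
  shows "bar_elt v I w J \<in> bar U"
proof -
  have "Poly_Mapping.keys (if transversal v w xs ys
      then Poly_Mapping.single (lines_between v w xs ys) (of_int (isgn xs * isgn ys) :: rat) else 0)
      \<subseteq> line_decomps U"
    if xs: "xs \<in> permutations_of_set I" and ys: "ys \<in> permutations_of_set J" for xs ys
  proof (cases "transversal v w xs ys")
    case True
    from lines_between_family[OF v w xs ys True] have "lines_between v w xs ys \<in> line_decomps U"
      unfolding line_decomps_family by blast
    with True show ?thesis by simp
  qed simp
  then show ?thesis
    unfolding bar_def bar_elt_def by (intro CollectI keys_sum_subset) simp_all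
qed

text \<open>The modular law for the line of \<open>p i\<close> inside the span of the vectors from i
  on, against the span of those before i.\<close>

lemma span_line_from_flags:
  assumes p: "basis_family p {..<n} U" and i: "i < n"
  shows "vflag p [0..<n] ! Suc i \<inter> vflag p (rev [0..<n]) ! (n - i) = span {p i}"
proof -
  have "span (p ` {i..<n}) \<inter> span (span {p i} \<union> span (p ` {..<i})) = span {p i}"
    using i by (intro Int_span_Un_modular span_mono basis_family_disjoint_Int[OF p]) auto
  moreover have "span (span {p i} \<union> span (p ` {..<i})) = span (p ` {..<Suc i})"
    using span_Un_cong[of "span {p i}" "{p i}" "span (p ` {..<i})" "p ` {..<i}"]
    by (simp add: span_span lessThan_Suc)
  moreover have "vflag p [0..<n] ! Suc i = span (p ` {..<Suc i})"
    using i by (subst nth_vflag) (simp_all add: atLeast0LessThan del: upt_Suc lessThan_Suc)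
  moreover have "vflag p (rev [0..<n]) ! (n - i) = span (p ` {i..<n})"
    using i by (subst nth_vflag) (simp_all add: take_rev)
  ultimately show ?thesis by (simp only: Int_commute)
qed

lemma opposite_rev:
  assumes p: "basis_family p {..<n} U"
  shows "opposite (vflag p [0..<n]) (vflag p (rev [0..<n]))"
proof -
  have "transversal p p [0..<n] [0..<n]"
    unfolding transversal_def
  proof (intro allI impI)
    fix k assume "k \<le> length [0..<n]"
    then show "span (p ` set (take k [0..<n])) \<inter> span (p ` set (drop k [0..<n])) = {0}"
      by (intro basis_family_disjoint_Int[OF p]) auto
  qed
  then show ?thesis by (simp add: transversal_opposite)
qed

text \<open>The coefficient of \<open>[P\<^sub>1|\<dots>|P\<^sub>n]\<close> in \<open>y\<close> can be read off \<open>beta y\<close> at the pair of opposite flags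
  of \<open>P\<^sub>1, \<dots>, P\<^sub>n\<close> and of \<open>P\<^sub>n, \<dots>, P\<^sub>1\<close>, which determine the lines \<open>P\<^sub>i\<close>.\<close>

lemma lookup_beta:
  assumes y: "y \<in> bar U" and p: "basis_family p {..<dim U} U"
  defines "n \<equiv> dim U"
  shows "Poly_Mapping.lookup (beta y) (vflag p [0..<n], vflag p (rev [0..<n])) =
    of_int (isgn (rev [0..<n])) * Poly_Mapping.lookup y (map (\<lambda>i. span {p i}) [0..<n])"
proof -
  let ?F = "vflag p [0..<n]" and ?G = "vflag p (rev [0..<n])" and ?P = "map (\<lambda>i. span {p i}) [0..<n]"
  let ?S = "insert ?P (Poly_Mapping.keys y)"
  have P: "?P \<in> line_decomps U" using p line_decomps_family unfolding n_def by blast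
  have "Poly_Mapping.lookup (Poly_Mapping.single (flag_of_lines Q) 1 \<otimes> apartment Q) (?F, ?G) =
      (of_int (isgn (rev [0..<n])) when Q = ?P)" if "Q \<in> ?S" for Q
  proof -
    have "Q \<in> line_decomps U" using that P y by (auto simp: bar_def)
    then obtain q where q: "basis_family q {..<n} U" "Q = map (\<lambda>i. span {q i}) [0..<n]"
      using line_decomps_family unfolding n_def by blast
    have eq: "Q = ?P" if "vflag q [0..<n] = ?F" "vflag q (rev [0..<n]) = ?G"
    proof -
      have "span {q i} = span {p i}" if "i < n" for i
        using span_line_from_flags[OF q(1) that] span_line_from_flags[OF p[folded n_def] that]
        unfolding \<open>vflag q [0..<n] = ?F\<close> \<open>vflag q (rev [0..<n]) = ?G\<close> by (rule trans[OF sym])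
      then show ?thesis unfolding q(2) by simp
    qed
    show ?thesis
    \<comment> \<open>If the first flags differ, the first tensor factor is zero at
      \<open>?F\<close>. If they agree, \<open>?G\<close> is opposite to the flag of q, so the
      second factor is nonzero only when the reversed flags agree too, and then the lines
      coincide.\<close>
    proof (cases "vflag q [0..<n] = ?F")
      case True
      then have "opposite (vflag q [0..<n]) ?G" using opposite_rev[OF p[folded n_def]] by simp
      from lookup_apt_opposite[OF q(1) this] have lookup:
        "Poly_Mapping.lookup (apartment Q) ?G =
          (if vflag q (rev [0..<n]) = ?G then of_int (isgn (rev [0..<n])) else 0)"
        unfolding q(2) apartment_family .
      have flag: "flag_of_lines Q = ?F" unfolding q(2) flag_of_lines_vflag by (rule True)
      show ?thesis
      proof (cases "Q = ?P")
        case QP: True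
        have "rev Q = rev ?P" unfolding QP ..
        then have "map (\<lambda>i. span {q i}) (rev [0..<n]) = map (\<lambda>i. span {p i}) (rev [0..<n])"
          unfolding q(2) rev_map .
        from arg_cong[OF this, of flag_of_lines] have "vflag q (rev [0..<n]) = ?G"
          unfolding flag_of_lines_vflag .
        then show ?thesis
          unfolding lookup_tensor lookup_single fst_conv snd_conv flag lookup by (simp add: QP)
      next
        case QP: False
        then have "vflag q (rev [0..<n]) \<noteq> ?G" using eq True by blast
        then show ?thesis
          unfolding lookup_tensor lookup_single fst_conv snd_conv flag lookup by (simp add: QP)
      qed
    next
      case False
      have "Q \<noteq> ?P"
      proof
        assume "Q = ?P"
        from arg_cong[OF this, of flag_of_lines] False show False
          unfolding q(2) flag_of_lines_vflag by contradiction
      qed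
      moreover have "flag_of_lines Q \<noteq> ?F" unfolding q(2) flag_of_lines_vflag by (rule False)
      ultimately show ?thesis by (simp add: lookup_tensor lookup_single)
    qed
  qed
  then have "(\<Sum>Q\<in>?S. Poly_Mapping.lookup y Q * Poly_Mapping.lookup
      (Poly_Mapping.single (flag_of_lines Q) 1 \<otimes> apartment Q) (?F, ?G)) =
    (\<Sum>Q\<in>?S. Poly_Mapping.lookup y Q * (of_int (isgn (rev [0..<n])) when Q = ?P))"
    by (intro sum.cong refl arg_cong2[where f = "(*)"])
  also have "\<dots> = (\<Sum>Q\<in>?S. if Q = ?P then of_int (isgn (rev [0..<n])) * Poly_Mapping.lookup y ?P else 0)"
    by (intro sum.cong refl) simp
  also have "\<dots> = of_int (isgn (rev [0..<n])) * Poly_Mapping.lookup y ?P"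
    by (subst sum.delta) simp_all
  finally show ?thesis
    unfolding beta_def by (subst lookup_lin[of ?S]) (simp_all add: subset_insertI)
qed

lemma inj_on_beta: "inj_on beta (bar U)"
proof (rule inj_onI, rule poly_mapping_eqI)
  fix y y' Ps assume y: "y \<in> bar U" "y' \<in> bar U" "beta y = beta y'"
  show "Poly_Mapping.lookup y Ps = Poly_Mapping.lookup y' Ps"
  proof (cases "Ps \<in> line_decomps U")
    case True
    then obtain p where p: "basis_family p {..<dim U} U" "Ps = map (\<lambda>i. span {p i}) [0..<dim U]"
      using line_decomps_family by blast
    have "isgn (rev [0..<dim U]) \<noteq> 0" using isgn_cases[of "rev [0..<dim U]"] by auto
    then show ?thesis
      using lookup_beta[OF y(1) p(1)] lookup_beta[OF y(2) p(1)] y(3) p(2) by simp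
  next
    case False
    then have "Ps \<notin> Poly_Mapping.keys y" "Ps \<notin> Poly_Mapping.keys y'" using y by (auto simp: bar_def)
    then show ?thesis by (simp add: in_keys_iff)
  qed
qed

lemma bar_embed_apt:
  assumes "basis_family v I U" "basis_family w J U"
  shows "bar_embed U (apt v I \<otimes> apt w J) = bar_elt v I w J"
  unfolding bar_embed_def beta_bar_elt[OF assms, symmetric]
  by (rule inv_into_f_f[OF inj_on_beta bar_elt_bar[OF assms]])

section \<open>The coproduct\<close>

text \<open>Let \<open>w' j\<close> be the component of \<open>w j\<close> in X along the span Y of
  the vectors indexed by J. As \<open>w j\<close> and \<open>w' j\<close> differ by an element of Y,
  they generate the same spaces together with Y, and the modular law gives the intersections.
  Singletons T give the lines of the formula, tails of orderings its flags.\<close>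

lemma basis_family_complement:
  assumes w: "basis_family w K U" and J: "J \<subseteq> K" and dd: "direct_decomp U X (span (w ` J))"
  obtains w' where "basis_family w' (K - J) X"
    "\<And>T. T \<subseteq> K - J \<Longrightarrow> X \<inter> span (w ` (T \<union> J)) = span (w' ` T)"
proof -
  let ?Y = "span (w ` J)"
  have X: "subspace X" "X \<inter> ?Y = {0}" and U: "U = {x + y | x y. x \<in> X \<and> y \<in> ?Y}"
    using dd by (auto simp: direct_decomp_def)
  have "\<forall>j\<in>K. \<exists>x. x \<in> X \<and> w j - x \<in> ?Y"
  proof
    fix j assume "j \<in> K"
    then have "w j \<in> U" using w span_base[of "w j" "w ` K"] by (auto simp: basis_family_def)
    then obtain x y where "w j = x + y" "x \<in> X" "y \<in> ?Y" unfolding U by blast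
    then show "\<exists>x. x \<in> X \<and> w j - x \<in> ?Y" by (intro exI[of _ x]) simp
  qed
  from bchoice[OF this] obtain w' where w': "\<And>j. j \<in> K \<Longrightarrow> w' j \<in> X"
    "\<And>j. j \<in> K \<Longrightarrow> w j - w' j \<in> ?Y" by blast
  have swap: "span (w ` (T \<union> J)) = span (w' ` T \<union> ?Y)" if "T \<subseteq> K - J" for T
  proof -
    have Y: "?Y \<subseteq> span (w ` (T \<union> J))" "?Y \<subseteq> span (w' ` T \<union> ?Y)"
      using span_superset[of "w' ` T \<union> ?Y"] by (auto intro!: span_mono)
    have "w j \<in> span (w' ` T \<union> ?Y)" if j: "j \<in> T" for j
    proof -
      have "w' j \<in> span (w' ` T \<union> ?Y)" using j by (intro span_base) simp
      moreover have "w j - w' j \<in> span (w' ` T \<union> ?Y)" using w'(2)[of j] j \<open>T \<subseteq> K - J\<close> Y by blast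
      ultimately have "w' j + (w j - w' j) \<in> span (w' ` T \<union> ?Y)" by (rule span_add)
      then show ?thesis by simp
    qed
    moreover have "w j \<in> span (w' ` T \<union> ?Y)" if "j \<in> J" for j
      using Y(2) span_base[of "w j" "w ` J"] that by blast
    ultimately have "w ` (T \<union> J) \<subseteq> span (w' ` T \<union> ?Y)" by blast
    moreover have "w' j \<in> span (w ` (T \<union> J))" if j: "j \<in> T" for j
    proof -
      have "w j \<in> span (w ` (T \<union> J))" using j by (intro span_base) simp
      moreover have "w j - w' j \<in> span (w ` (T \<union> J))" using w'(2)[of j] j \<open>T \<subseteq> K - J\<close> Y by blast
      ultimately have "w j - (w j - w' j) \<in> span (w ` (T \<union> J))" by (rule span_diff)
      then show ?thesis by simp
    qed
    then have "w' ` T \<union> ?Y \<subseteq> span (w ` (T \<union> J))" using Y(1) by blast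
    ultimately show ?thesis unfolding span_eq by blast
  qed
  have Int: "X \<inter> span (w ` (T \<union> J)) = span (w' ` T)" if T: "T \<subseteq> K - J" for T
  proof -
    have "span (w' ` T) \<subseteq> X" using w'(1) T X(1) by (intro span_minimal) auto
    then have "X \<inter> span (span (w' ` T) \<union> ?Y) = span (w' ` T)"
      by (intro Int_span_Un_modular X subspace_span)
    moreover have "span (span (w' ` T) \<union> ?Y) = span (w' ` T \<union> ?Y)"
      by (rule span_Un_cong) (simp_all add: span_span)
    ultimately show ?thesis using swap[OF T] by simp
  qed
  \<comment> \<open>A dependency among the projections becomes one among the vectors of w once an
    element of Y is added.\<close>
  have notin: "w' j \<notin> span (w' ` T)" if "T \<subseteq> K - J" "j \<in> K - J" "j \<notin> T" for j T
  proof
    assume "w' j \<in> span (w' ` T)"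
    then have "w' j \<in> span (w ` (T \<union> J))" using Int[OF that(1)] by blast
    moreover have "w j - w' j \<in> span (w ` (T \<union> J))"
      using w'(2)[of j] that(2) span_mono[of "w ` J" "w ` (T \<union> J)"] by blast
    ultimately have "w' j + (w j - w' j) \<in> span (w ` (T \<union> J))" by (rule span_add)
    moreover have "w j \<notin> span (w ` (T \<union> J))"
      using that J by (intro basis_family_notin_span[OF w]) auto
    ultimately show False by simp
  qed
  have "basis_family w' (K - J) X"
    unfolding basis_family_def
  proof (intro conjI)
    show "finite (K - J)" using w by (simp add: basis_family_def)
    show "inj_on w' (K - J)"
    proof (rule inj_onI, rule ccontr)
      fix i j assume ij: "i \<in> K - J" "j \<in> K - J" "w' i = w' j" "i \<noteq> j"
      have "w' j \<in> span (w' ` {i})" using ij(3) by (intro span_base) simp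
      then show False using notin[of "{i}" j] ij by blast
    qed
    show "independent (w' ` (K - J))"
    proof
      assume "dependent (w' ` (K - J))"
      then obtain j where j: "j \<in> K - J" "w' j \<in> span (w' ` (K - J) - {w' j})"
        unfolding dependent_def by blast
      have "w' ` (K - J) - {w' j} \<subseteq> w' ` (K - J - {j})" by blast
      then have "w' j \<in> span (w' ` (K - J - {j}))" using j(2) span_mono by blast
      then show False using notin[of "K - J - {j}" j] j(1) by blast
    qed
    have "X \<subseteq> U"
    proof
      fix x assume "x \<in> X"
      then have "x + 0 \<in> U" unfolding U using span_zero by blast
      then show "x \<in> U" by simp
    qed
    moreover have "K - J \<union> J = K" using J by blast
    ultimately show "span (w' ` (K - J)) = X"
      using Int[of "K - J"] w by (auto simp: basis_family_def)
  qed
  then show thesis using that Int by blast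
qed

lemma direct_decomp_commute: "direct_decomp U X Y \<Longrightarrow> direct_decomp U Y X"
  unfolding direct_decomp_def by (auto simp: Int_commute) (metis add.commute)+

text \<open>At a cut in the first half the tail contains all of J, so inside the span of the vectors
  of I it may be replaced by its projection \<open>w'\<close>; at a later cut the head contains all
  of I and \<open>v'\<close> plays this role. The case T = {} of the hypotheses says that the two
  spans meet trivially.\<close>

lemma transversal_lines_append:
  assumes xs: "xs \<in> permutations_of_set I" and ys': "ys' \<in> permutations_of_set J"
    and len: "length xs = length ys" "length xs' = length ys'"
    and sub: "set ys \<subseteq> J'" "set xs' \<subseteq> I'"
    and w': "\<And>T. T \<subseteq> J' \<Longrightarrow> span (v ` I) \<inter> span (w ` (T \<union> J)) = span (w' ` T)"
    and v': "\<And>T. T \<subseteq> I' \<Longrightarrow> span (w ` J) \<inter> span (v ` (T \<union> I)) = span (v' ` T)"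
  shows "transversal v w (xs @ xs') (ys @ ys') \<longleftrightarrow> transversal v w' xs ys \<and> transversal v' w xs' ys'"
    and "lines_between v w (xs @ xs') (ys @ ys') = lines_between v w' xs ys @ lines_between v' w xs' ys'"
proof -
  note px = permutations_of_setE[OF xs] and py = permutations_of_setE[OF ys']
  have low: "span (v ` set (take a xs)) \<inter> span (w ` (set (drop m ys) \<union> J)) =
      span (v ` set (take a xs)) \<inter> span (w' ` set (drop m ys))" for a m
  proof -
    have "span (v ` set (take a xs)) \<subseteq> span (v ` I)"
      using px set_take_subset[of a xs] by (intro span_mono image_mono) simp
    moreover have "span (v ` I) \<inter> span (w ` (set (drop m ys) \<union> J)) = span (w' ` set (drop m ys))"
      using sub set_drop_subset[of m ys] by (intro w') blast
    ultimately show ?thesis by blast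
  qed
  have high: "span (v ` (I \<union> set (take a xs'))) \<inter> span (w ` set (drop m ys')) =
      span (v' ` set (take a xs')) \<inter> span (w ` set (drop m ys'))" for a m
  proof -
    have "span (w ` set (drop m ys')) \<subseteq> span (w ` J)"
      using py set_drop_subset[of m ys'] by (intro span_mono image_mono) simp
    moreover have "span (w ` J) \<inter> span (v ` (set (take a xs') \<union> I)) = span (v' ` set (take a xs'))"
      using sub set_take_subset[of a xs'] by (intro v') blast
    moreover have "set (take a xs') \<union> I = I \<union> set (take a xs')" by blast
    ultimately show ?thesis by auto
  qed
  \<comment> \<open>Two separate cut positions are allowed: transversality uses a = m, the lines use
    a = m + 1.\<close>
  have le: "span (v ` set (take a (xs @ xs'))) \<inter> span (w ` set (drop m (ys @ ys'))) =
      span (v ` set (take a xs)) \<inter> span (w' ` set (drop m ys))"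
    if "a \<le> length xs" "m \<le> length xs" for a m
    using low[of a m] that len py by simp
  have ge: "span (v ` set (take (length xs + a) (xs @ xs'))) \<inter> span (w ` set (drop (length xs + m) (ys @ ys'))) =
      span (v' ` set (take a xs')) \<inter> span (w ` set (drop m ys'))" for a m
    using high[of a m] len px by simp
  have "transversal v w (xs @ xs') (ys @ ys') \<longleftrightarrow>
      (\<forall>k\<le>length xs. span (v ` set (take k (xs @ xs'))) \<inter> span (w ` set (drop k (ys @ ys'))) = {0}) \<and>
      (\<forall>k\<le>length xs'. span (v ` set (take (length xs + k) (xs @ xs'))) \<inter>
        span (w ` set (drop (length xs + k) (ys @ ys'))) = {0})" (is "?t \<longleftrightarrow> ?l \<and> ?h")
  proof
    assume t: ?t
    then have "span (v ` set (take k (xs @ xs'))) \<inter> span (w ` set (drop k (ys @ ys'))) = {0}"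
      if "k \<le> length xs + length xs'" for k
      using that unfolding transversal_def length_append by blast
    then show "?l \<and> ?h" by (metis add_le_cancel_left trans_le_add1)
  next
    assume lh: "?l \<and> ?h"
    show ?t unfolding transversal_def length_append
    proof (intro allI impI)
      fix k assume k: "k \<le> length xs + length xs'"
      show "span (v ` set (take k (xs @ xs'))) \<inter> span (w ` set (drop k (ys @ ys'))) = {0}"
      proof (cases "k \<le> length xs")
        case True
        then show ?thesis using lh by blast
      next
        case False
        then have "k = length xs + (k - length xs)" "k - length xs \<le> length xs'" using k by auto
        then show ?thesis using lh by metis
      qed
    qed
  qed
  also have "?l \<longleftrightarrow> transversal v w' xs ys"
    unfolding transversal_def by (intro all_cong) (simp only: le)
  also have "?h \<longleftrightarrow> transversal v' w xs' ys'"
    unfolding transversal_def by (intro all_cong) (simp only: ge)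
  finally show "transversal v w (xs @ xs') (ys @ ys') \<longleftrightarrow>
      transversal v w' xs ys \<and> transversal v' w xs' ys'" .
  show "lines_between v w (xs @ xs') (ys @ ys') = lines_between v w' xs ys @ lines_between v' w xs' ys'"
  proof (rule nth_equalityI)
    fix k assume "k < length (lines_between v w (xs @ xs') (ys @ ys'))"
    then have k: "k < length xs + length xs'" by (simp add: lines_between_def)
    then have nth: "lines_between v w (xs @ xs') (ys @ ys') ! k =
        span (v ` set (take (Suc k) (xs @ xs'))) \<inter> span (w ` set (drop k (ys @ ys')))"
      by (simp add: lines_between_def)
    show "lines_between v w (xs @ xs') (ys @ ys') ! k =
        (lines_between v w' xs ys @ lines_between v' w xs' ys') ! k"
    proof (cases "k < length xs")
      case True
      then show ?thesis using le[of "Suc k" k] unfolding nth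
        by (simp add: lines_between_def nth_append)
    next
      case False
      define m where "m = k - length xs"
      have m: "k = length xs + m" "m < length xs'" using False k by (auto simp: m_def)
      have "(lines_between v w' xs ys @ lines_between v' w xs' ys') ! k =
          span (v' ` set (take (Suc m) xs')) \<inter> span (w ` set (drop m ys'))"
        using m by (simp add: lines_between_def nth_append)
      moreover have "Suc k = length xs + Suc m" using m by simp
      ultimately show ?thesis unfolding nth using ge[of "Suc m" m] m(1) by metis
    qed
  qed (simp add: lines_between_def)
qed

lemma flinear_deconc: "flinear deconc"
  unfolding deconc_def by (rule flinear_lin)

text \<open>Identifies the summand of a deconcatenation: by the adapted basis, heads of the frame
  span entries of the first flag and tails entries of the second.\<close>

lemma span_take_drop_lines:
  assumes v: "basis_family v I U" and w: "basis_family w J U"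
    and xs: "xs \<in> permutations_of_set I" and ys: "ys \<in> permutations_of_set J"
    and tr: "transversal v w xs ys" and k: "k \<le> dim U"
  shows "span (\<Union>(set (take k (lines_between v w xs ys)))) = span (v ` set (take k xs))"
    and "span (\<Union>(set (drop k (lines_between v w xs ys)))) = span (w ` set (drop k ys))"
proof -
  have len: "length xs = dim U" "length ys = dim U"
    using permutations_of_setE[OF xs] permutations_of_setE[OF ys]
      basis_family_dim[OF v] basis_family_dim[OF w] by simp_all
  obtain p where p: "basis_family p {..<dim U} U"
    "lines_between v w xs ys = map (\<lambda>i. span {p i}) [0..<dim U]"
    "vflag p [0..<dim U] = vflag v xs" "vflag p (rev [0..<dim U]) = vflag w (rev ys)"
    by (rule lines_between_family[OF v w xs ys tr])
  have "span (\<Union>(set (take k (lines_between v w xs ys)))) = span (p ` set (take k [0..<dim U]))"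
    unfolding p(2) take_map set_map by (rule span_Union_lines)
  also have "\<dots> = vflag p [0..<dim U] ! k" using k by (subst nth_vflag) simp_all
  also have "\<dots> = span (v ` set (take k xs))" unfolding p(3) using k len by (subst nth_vflag) simp_all
  finally show "span (\<Union>(set (take k (lines_between v w xs ys)))) = span (v ` set (take k xs))" .
  have "span (\<Union>(set (drop k (lines_between v w xs ys)))) = span (p ` set (drop k [0..<dim U]))"
    unfolding p(2) drop_map set_map by (rule span_Union_lines)
  also have "\<dots> = vflag p (rev [0..<dim U]) ! (dim U - k)"
    using k by (subst nth_vflag) (simp_all add: take_rev)
  also have "\<dots> = span (w ` set (drop k ys))"
    unfolding p(4) using k len by (subst nth_vflag) (simp_all add: take_rev)
  finally show "span (\<Union>(set (drop k (lines_between v w xs ys)))) = span (w ` set (drop k ys))" .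
qed

definition deconc_term ::
  "(nat \<Rightarrow> 'v) \<Rightarrow> (nat \<Rightarrow> 'v) \<Rightarrow> nat \<Rightarrow> nat list \<Rightarrow> nat list \<Rightarrow>
    (('v set \<times> 'v set) \<times> ('v set list \<times> 'v set list) \<Rightarrow>\<^sub>0 rat)" where
  "deconc_term v w k xs ys = (if transversal v w xs ys then
    in_summand (span (v ` set (take k xs)), span (w ` set (drop k ys)))
      (Poly_Mapping.single (take k (lines_between v w xs ys), drop k (lines_between v w xs ys))
        (of_int (isgn xs * isgn ys))) else 0)"

lemma deconc_bar_elt:
  assumes v: "basis_family v I U" and w: "basis_family w J U"
  shows "deconc (bar_elt v I w J) = (\<Sum>xs\<in>permutations_of_set I. \<Sum>ys\<in>permutations_of_set J.
    \<Sum>k\<le>dim U. deconc_term v w k xs ys)"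
  unfolding bar_elt_def flinear_sum[OF flinear_deconc]
proof (intro sum.cong refl)
  fix xs ys assume xs: "xs \<in> permutations_of_set I" and ys: "ys \<in> permutations_of_set J"
  let ?L = "lines_between v w xs ys" and ?c = "of_int (isgn xs * isgn ys) :: rat"
  show "deconc (if transversal v w xs ys then Poly_Mapping.single ?L ?c else 0) =
    (\<Sum>k\<le>dim U. deconc_term v w k xs ys)"
  proof (cases "transversal v w xs ys")
    case True
    have len: "length ?L = dim U"
      using permutations_of_setE[OF xs] basis_family_dim[OF v] by (simp add: lines_between_def)
    have "deconc (Poly_Mapping.single ?L ?c) = (\<Sum>k\<le>dim U. fscale ?c
      (in_summand (span (\<Union>(set (take k ?L))), span (\<Union>(set (drop k ?L))))
        (Poly_Mapping.single (take k ?L) 1 \<otimes> Poly_Mapping.single (drop k ?L) 1)))"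
      by (simp only: deconc_def lin_single free.scale_sum_right len)
    also have "\<dots> = (\<Sum>k\<le>dim U. deconc_term v w k xs ys)"
    proof (rule sum.cong[OF refl])
      fix k assume "k \<in> {..dim U}"
      then show "fscale ?c (in_summand (span (\<Union>(set (take k ?L))), span (\<Union>(set (drop k ?L))))
          (Poly_Mapping.single (take k ?L) 1 \<otimes> Poly_Mapping.single (drop k ?L) 1)) =
        deconc_term v w k xs ys"
        using span_take_drop_lines[OF v w xs ys True, of k] True
        by (simp add: deconc_term_def tensor_single fscale_single flip: flinear_scale[OF flinear_in_summand])
    qed
    finally show ?thesis using True by simp
  next
    case False
    then show ?thesis by (simp add: deconc_term_def flinear_zero[OF flinear_deconc])
  qed
qed

lemma direct_decomp_span_Un: "direct_decomp (span (A \<union> B)) (span A) (span B) \<longleftrightarrow> span A \<inter> span B = {0}"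
  by (auto simp: direct_decomp_def span_Un)

text \<open>Reconciles two index sets: cutting orderings yields pairs with matching cardinalities,
  the formula sums over direct decompositions.\<close>

lemma direct_decomp_card:
  assumes v: "basis_family v K V" and w: "basis_family w K V" and IJ: "I \<subseteq> K" "J \<subseteq> K"
  shows "direct_decomp V (span (v ` I)) (span (w ` J)) \<longleftrightarrow>
    card I = card (K - J) \<and> span (v ` I) \<inter> span (w ` J) = {0}"
proof
  assume dd: "direct_decomp V (span (v ` I)) (span (w ` J))"
  obtain w' where "basis_family w' (K - J) (span (v ` I))"
    using basis_family_complement[OF w IJ(2) dd] by blast
  then have "dim (span (v ` I)) = card (K - J)" by (rule basis_family_dim)
  then show "card I = card (K - J) \<and> span (v ` I) \<inter> span (w ` J) = {0}"
    using basis_family_dim[OF basis_family_subset[OF v IJ(1)]] dd by (simp add: direct_decomp_def)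
next
  assume *: "card I = card (K - J) \<and> span (v ` I) \<inter> span (w ` J) = {0}"
  note b = basis_family_subset[OF v IJ(1)] basis_family_subset[OF w IJ(2)]
  have fin: "finite K" using v by (simp add: basis_family_def)
  have "span (v ` I \<union> w ` J) = V"
  proof (rule span_Un_direct_eq[of _ "v ` K"])
    show "independent (v ` I)" "independent (w ` J)" "finite (v ` I)" "finite (w ` J)"
      using b by (auto simp: basis_family_def)
    show "v ` I \<subseteq> V" "w ` J \<subseteq> V"
      using v w IJ span_superset[of "v ` K"] span_superset[of "w ` K"] unfolding basis_family_def by blast+
    have "card (v ` I) = card I" "card (w ` J) = card J"
      using b by (auto simp: basis_family_def card_image)
    moreover have "card (K - J) = card K - card J" "card J \<le> card K"
      using IJ fin by (auto simp: card_Diff_subset finite_subset card_mono)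
    ultimately show "card (v ` I) + card (w ` J) = dim V"
      using * basis_family_dim[OF v] by simp
  qed (use v * in \<open>auto simp: basis_family_def\<close>)
  then show "direct_decomp V (span (v ` I)) (span (w ` J))"
    using * direct_decomp_span_Un[of "v ` I" "w ` J"] by simp
qed

text \<open>Transversality, lines and signs all split along the cut, so the fourfold sum factors
  into two bar elements; only the inversions across the cuts remain, as two shuffle signs.\<close>

lemma sum_deconc_term:
  assumes fin: "finite K" and IJ: "I \<subseteq> K" "J \<subseteq> K" "card I = card (K - J)"
    and w': "\<And>T. T \<subseteq> K - J \<Longrightarrow> span (v ` I) \<inter> span (w ` (T \<union> J)) = span (w' ` T)"
    and v': "\<And>T. T \<subseteq> K - I \<Longrightarrow> span (w ` J) \<inter> span (v ` (T \<union> I)) = span (v' ` T)"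
  shows "(\<Sum>xs\<in>permutations_of_set I. \<Sum>ys\<in>permutations_of_set (K - J).
      \<Sum>xs'\<in>permutations_of_set (K - I). \<Sum>ys'\<in>permutations_of_set J.
        deconc_term v w (card I) (xs @ xs') (ys @ ys')) =
    fscale (of_int (cross_sgn I (K - I)) * of_int (cross_sgn (K - J) J))
      (in_summand (span (v ` I), span (w ` J)) (bar_elt v I w' (K - J) \<otimes> bar_elt v' (K - I) w J))"
proof -
  let ?c = "of_int (cross_sgn I (K - I)) * of_int (cross_sgn (K - J) J) :: rat"
  let ?i = "in_summand (span (v ` I), span (w ` J)) ::
    ('v set list \<times> 'v set list \<Rightarrow>\<^sub>0 rat) \<Rightarrow> _"
  have summand: "deconc_term v w (card I) (xs @ xs') (ys @ ys') = fscale ?c (?i (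
      (if transversal v w' xs ys
       then Poly_Mapping.single (lines_between v w' xs ys) (of_int (isgn xs * isgn ys)) else 0) \<otimes>
      (if transversal v' w xs' ys'
       then Poly_Mapping.single (lines_between v' w xs' ys') (of_int (isgn xs' * isgn ys')) else 0)))"
    if perms: "xs \<in> permutations_of_set I" "ys \<in> permutations_of_set (K - J)"
      "xs' \<in> permutations_of_set (K - I)" "ys' \<in> permutations_of_set J" for xs ys xs' ys'
  proof -
    note p = permutations_of_setE[OF perms(1)] permutations_of_setE[OF perms(2)]
      permutations_of_setE[OF perms(3)] permutations_of_setE[OF perms(4)]
    have card: "card (K - I) = card J"
      using IJ fin card_mono[OF fin IJ(1)] card_mono[OF fin IJ(2)]
      by (simp add: card_Diff_subset finite_subset)
    have len: "length xs = card I" "length ys = card I" "length xs' = length ys'"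
      using p IJ(3) card by simp_all
    have a: "length xs = length ys" "set ys \<subseteq> K - J" "set xs' \<subseteq> K - I" using p len by simp_all
    have tr: "transversal v w (xs @ xs') (ys @ ys') \<longleftrightarrow> transversal v w' xs ys \<and> transversal v' w xs' ys'"
      by (rule transversal_lines_append(1)[OF perms(1,4) a(1) len(3) a(2,3)]) (erule w', erule v')
    have li: "lines_between v w (xs @ xs') (ys @ ys') = lines_between v w' xs ys @ lines_between v' w xs' ys'"
      by (rule transversal_lines_append(2)[OF perms(1,4) a(1) len(3) a(2,3)]) (erule w', erule v')
    have lli: "length (lines_between v w' xs ys) = card I" using len by (simp add: lines_between_def)
    have parts: "set (take (card I) (xs @ xs')) = I" "set (drop (card I) (ys @ ys')) = J"
      using len p(1) p(13) by simp_all
    have sgn: "isgn (xs @ xs') = isgn xs * isgn xs' * cross_sgn I (K - I)"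
      "isgn (ys @ ys') = isgn ys * isgn ys' * cross_sgn (K - J) J"
      using p by (subst isgn_append; auto)+
    have "deconc_term v w (card I) (xs @ xs') (ys @ ys') =
      (if transversal v w' xs ys \<and> transversal v' w xs' ys' then
        ?i (Poly_Mapping.single (lines_between v w' xs ys, lines_between v' w xs' ys')
          (?c * (of_int (isgn xs * isgn ys) * of_int (isgn xs' * isgn ys')))) else 0)"
      unfolding deconc_term_def tr li parts sgn using lli by (simp add: mult_ac)
    then show ?thesis
      by (simp add: flinear_zero[OF flinear_in_summand] tensor_zero_left tensor_zero_right
          tensor_single fscale_single flip: flinear_scale[OF flinear_in_summand])
  qed
  show ?thesis
    unfolding bar_elt_def tensor_sum_left
    unfolding tensor_sum_right flinear_sum[OF flinear_in_summand] free.scale_sum_right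
    by (intro sum.cong refl summand)
qed

text \<open>\<open>lower\<close> and \<open>upper\<close> are only assumed to take the right value
  for every adapted basis, so the projected bases may be chosen separately for each pair.\<close>

lemma coproduct_apt:
  assumes v: "basis_family v K V" and w: "basis_family w K V"
    and lower: "\<And>I J w'. basis_family w' (K - J) (span (v ` I)) \<Longrightarrow> I \<subseteq> K \<Longrightarrow> J \<subseteq> K \<Longrightarrow>
      (\<And>T. T \<subseteq> K - J \<Longrightarrow> span (v ` I) \<inter> span (w ` (T \<union> J)) = span (w' ` T)) \<Longrightarrow>
      lower I J = apt v I \<otimes> apt w' (K - J)"
    and upper: "\<And>I J v'. basis_family v' (K - I) (span (w ` J)) \<Longrightarrow> I \<subseteq> K \<Longrightarrow> J \<subseteq> K \<Longrightarrow>
      (\<And>T. T \<subseteq> K - I \<Longrightarrow> span (w ` J) \<inter> span (v ` (T \<union> I)) = span (v' ` T)) \<Longrightarrow>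
      upper I J = apt v' (K - I) \<otimes> apt w J"
  shows "coproduct V (apt v K \<otimes> apt w K) =
    (\<Sum>(I, J)\<in>{(I, J). I \<subseteq> K \<and> J \<subseteq> K \<and> direct_decomp V (span (v ` I)) (span (w ` J))}.
      fscale (of_int (cross_sgn I (K - I)) * of_int (cross_sgn (K - J) J))
        (in_summand (span (v ` I), span (w ` J)) (lower I J \<otimes> upper I J)))"
proof -
  let ?Phi = "tensor_map id (tensor_map beta beta) ::
    (('v set \<times> 'v set) \<times> ('v set list \<times> 'v set list) \<Rightarrow>\<^sub>0 rat) \<Rightarrow> _"
  let ?P = permutations_of_set
  let ?Q = "{(I, J). I \<subseteq> K \<and> J \<subseteq> K \<and> card I = card (K - J)}"
  let ?pairs = "{(I, J). I \<subseteq> K \<and> J \<subseteq> K \<and> direct_decomp V (span (v ` I)) (span (w ` J))}"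
  let ?s = "\<lambda>I J. \<Sum>xs\<in>?P I. \<Sum>ys\<in>?P (K - J). \<Sum>xs'\<in>?P (K - I). \<Sum>ys'\<in>?P J.
        deconc_term v w (card I) (xs @ xs') (ys @ ys')"
  have fin: "finite K" using v by (simp add: basis_family_def)
  have finQ: "finite ?Q" by (rule finite_subset[of _ "Pow K \<times> Pow K"]) (use fin in auto)
  have "coproduct V (apt v K \<otimes> apt w K) = ?Phi (\<Sum>(I, J)\<in>?Q. ?s I J)"
    unfolding coproduct_def bar_embed_apt[OF v w] deconc_bar_elt[OF v w] basis_family_dim[OF v]
    by (subst sum_permutations_split[OF fin]) rule
  \<comment> \<open>If the two spans meet nontrivially, transversality fails at the cut
    \<open>card I\<close> for all orderings concerned, so such pairs contribute nothing.\<close>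
  also have "(\<Sum>(I, J)\<in>?Q. ?s I J) = (\<Sum>(I, J)\<in>?pairs. ?s I J)"
  proof (rule sum.mono_neutral_right[OF finQ])
    show "?pairs \<subseteq> ?Q" using direct_decomp_card[OF v w] by auto
    show "\<forall>q\<in>?Q - ?pairs. (case q of (I, J) \<Rightarrow> ?s I J) = 0"
    proof
      fix q assume q: "q \<in> ?Q - ?pairs"
      obtain I J where IJq: "q = (I, J)" by (cases q)
      then have IJ: "I \<subseteq> K" "J \<subseteq> K" "card I = card (K - J)" "(I, J) \<notin> ?pairs" using q by auto
      then have ne: "span (v ` I) \<inter> span (w ` J) \<noteq> {0}" using direct_decomp_card[OF v w] by auto
      show "(case q of (I, J) \<Rightarrow> ?s I J) = 0"
        unfolding IJq prod.case
      proof (intro sum.neutral ballI)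
        fix xs ys xs' ys' assume perms: "xs \<in> ?P I" "ys \<in> ?P (K - J)" "xs' \<in> ?P (K - I)" "ys' \<in> ?P J"
        note p = permutations_of_setE[OF perms(1)] permutations_of_setE[OF perms(2)]
          permutations_of_setE[OF perms(4)]
        have "\<not> transversal v w (xs @ xs') (ys @ ys')"
        proof
          assume "transversal v w (xs @ xs') (ys @ ys')"
          moreover have "card I \<le> length (xs @ xs')" using p(3) by simp
          ultimately have "span (v ` set (take (card I) (xs @ xs'))) \<inter>
              span (w ` set (drop (card I) (ys @ ys'))) = {0}"
            unfolding transversal_def by blast
          then show False using ne p IJ(3) by simp
        qed
        then show "deconc_term v w (card I) (xs @ xs') (ys @ ys') = 0" by (simp add: deconc_term_def)
      qed
    qed
  qed
  also have "?Phi \<dots> = (\<Sum>(I, J)\<in>?pairs. ?Phi (?s I J))"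
    by (simp add: flinear_sum[OF flinear_tensor_map] split_def)
  also have "\<dots> = (\<Sum>(I, J)\<in>?pairs.
      fscale (of_int (cross_sgn I (K - I)) * of_int (cross_sgn (K - J) J))
        (in_summand (span (v ` I), span (w ` J)) (lower I J \<otimes> upper I J)))"
  proof (intro sum.cong refl, clarify)
    fix I J assume IJ: "I \<subseteq> K" "J \<subseteq> K" and dd: "direct_decomp V (span (v ` I)) (span (w ` J))"
    obtain w' where w': "basis_family w' (K - J) (span (v ` I))"
      "\<And>T. T \<subseteq> K - J \<Longrightarrow> span (v ` I) \<inter> span (w ` (T \<union> J)) = span (w' ` T)"
      using basis_family_complement[OF w IJ(2) dd] by blast
    obtain v' where v': "basis_family v' (K - I) (span (w ` J))"
      "\<And>T. T \<subseteq> K - I \<Longrightarrow> span (w ` J) \<inter> span (v ` (T \<union> I)) = span (v' ` T)"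
      using basis_family_complement[OF v IJ(1) direct_decomp_commute[OF dd]] by blast
    have "card I = card (K - J)" using dd direct_decomp_card[OF v w IJ] by blast
    have eq: "?s I J = fscale (of_int (cross_sgn I (K - I)) * of_int (cross_sgn (K - J) J))
        (in_summand (span (v ` I), span (w ` J)) (bar_elt v I w' (K - J) \<otimes> bar_elt v' (K - I) w J))"
      by (rule sum_deconc_term[OF fin IJ \<open>card I = _\<close>]) (erule w'(2), erule v'(2))
    have lo: "lower I J = apt v I \<otimes> apt w' (K - J)"
      by (rule lower[OF w'(1) IJ]) (erule w'(2))
    have up: "upper I J = apt v' (K - I) \<otimes> apt w J"
      by (rule upper[OF v'(1) IJ]) (erule v'(2))
    show "?Phi (?s I J) = fscale (of_int (cross_sgn I (K - I)) * of_int (cross_sgn (K - J) J))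
        (in_summand (span (v ` I), span (w ` J)) (lower I J \<otimes> upper I J))"
      \<comment> \<open>The apartments are rewritten backwards as images of bar elements, so that
        both sides become values of \<open>beta\<close> in each tensor factor.\<close>
      unfolding eq lo up
        beta_bar_elt[OF basis_family_subset[OF v IJ(1)] w'(1), symmetric]
        beta_bar_elt[OF v'(1) basis_family_subset[OF w IJ(2)], symmetric]
      by (simp only: flinear_scale[OF flinear_tensor_map] tensor_map_in_summand[OF flinear_tensor_map]
          tensor_map_tensor[OF flinear_beta flinear_beta])
  qed
  finally show ?thesis .
qed

section \<open>The terms of the formula in terms of adapted bases\<close>

lemma basis_family_is_basis_list:
  "is_basis_list U (map v xs) \<Longrightarrow> basis_family v (set xs) U"
  by (auto simp: is_basis_list_def basis_family_def distinct_map)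

lemma basis_family_line_decomps:
  assumes "basis_family v I U"
  shows "map (\<lambda>i. span {v i}) (sorted_list_of_set I) \<in> line_decomps U"
  using assms unfolding line_decomps_def is_basis_list_def basis_family_def
  by (intro CollectI exI[of _ "map v (sorted_list_of_set I)"] conjI)
    (simp_all add: distinct_map)

lemma meet_lines_eq:
  assumes "finite T" and w': "\<And>S. S \<subseteq> T \<Longrightarrow> X \<inter> span (w ` (S \<union> J)) = span (w' ` S)"
  shows "meet_lines X w T (span (w ` J)) = map (\<lambda>j. span {w' j}) (sorted_list_of_set T)"
  unfolding meet_lines_def
proof (rule map_cong[OF refl])
  fix j assume "j \<in> set (sorted_list_of_set T)"
  then have "X \<inter> span (w ` ({j} \<union> J)) = span (w' ` {j})" using assms(1) by (intro w') simp
  moreover have "span (insert (w j) (span (w ` J))) = span (w ` ({j} \<union> J))"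
    using span_insert_cong[of "span (w ` J)" "w ` J" "w j"] by (simp add: span_span)
  ultimately show "X \<inter> span (insert (w j) (span (w ` J))) = span {w' j}" by simp
qed

lemma lower_term_apt:
  assumes "finite I" "\<And>T. T \<subseteq> {1..d} - J \<Longrightarrow> span (v ` I) \<inter> span (w ` (T \<union> J)) = span (w' ` T)"
  shows "lower_term d v w I J = apt v I \<otimes> apt w' ({1..d} - J)"
proof -
  have "meet_lines (span (v ` I)) w ({1..d} - J) (span (w ` J)) =
      map (\<lambda>j. span {w' j}) (sorted_list_of_set ({1..d} - J))"
    by (rule meet_lines_eq) (simp, erule assms(2))
  then show ?thesis
    using assms(1) by (simp add: lower_term_def sub_span_def vec_apartment_apt apartment_apt)
qed

lemma upper_term_apt:
  assumes "finite J" "\<And>T. T \<subseteq> {1..d} - I \<Longrightarrow> span (w ` J) \<inter> span (v ` (T \<union> I)) = span (v' ` T)"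
  shows "upper_term d v w I J = apt v' ({1..d} - I) \<otimes> apt w J"
proof -
  have "meet_lines (span (w ` J)) v ({1..d} - I) (span (v ` I)) =
      map (\<lambda>j. span {v' j}) (sorted_list_of_set ({1..d} - I))"
    by (rule meet_lines_eq) (simp, erule assms(2))
  then show ?thesis
    using assms(1) by (simp add: upper_term_def sub_span_def vec_apartment_apt apartment_apt)
qed

lemma tensor_apt_St2:
  "basis_family v I U \<Longrightarrow> basis_family w J U \<Longrightarrow> apt v I \<otimes> apt w J \<in> St2 U"
  unfolding St2_def by (intro free.span_base) (blast intro: apt_St)

text \<open>Well-formedness of the formula: the listed intersections really are lines decomposing
  the two summands, because they are spanned by the projected bases.\<close>

lemma meet_lines_term_props:
  assumes v: "basis_family v {1..d} V" and w: "basis_family w {1..d} V"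
    and IJ: "I \<subseteq> {1..d}" "J \<subseteq> {1..d}" and dd: "direct_decomp V (span (v ` I)) (span (w ` J))"
  shows "meet_lines (span (v ` I)) w ({1..d} - J) (span (w ` J)) \<in> line_decomps (span (v ` I))"
    and "meet_lines (span (w ` J)) v ({1..d} - I) (span (v ` I)) \<in> line_decomps (span (w ` J))"
    and "lower_term d v w I J \<in> St2 (span (v ` I))"
    and "upper_term d v w I J \<in> St2 (span (w ` J))"
proof -
  have fin: "finite I" "finite J" using IJ by (auto intro: finite_subset)
  obtain w' where w': "basis_family w' ({1..d} - J) (span (v ` I))"
    "\<And>T. T \<subseteq> {1..d} - J \<Longrightarrow> span (v ` I) \<inter> span (w ` (T \<union> J)) = span (w' ` T)"
    using basis_family_complement[OF w IJ(2) dd] by blast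
  obtain v' where v': "basis_family v' ({1..d} - I) (span (w ` J))"
    "\<And>T. T \<subseteq> {1..d} - I \<Longrightarrow> span (w ` J) \<inter> span (v ` (T \<union> I)) = span (v' ` T)"
    using basis_family_complement[OF v IJ(1) direct_decomp_commute[OF dd]] by blast
  have "meet_lines (span (v ` I)) w ({1..d} - J) (span (w ` J)) =
      map (\<lambda>j. span {w' j}) (sorted_list_of_set ({1..d} - J))"
    by (rule meet_lines_eq) (simp, erule w'(2))
  then show "meet_lines (span (v ` I)) w ({1..d} - J) (span (w ` J)) \<in> line_decomps (span (v ` I))"
    using basis_family_line_decomps[OF w'(1)] by simp
  have "meet_lines (span (w ` J)) v ({1..d} - I) (span (v ` I)) =
      map (\<lambda>j. span {v' j}) (sorted_list_of_set ({1..d} - I))"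
    by (rule meet_lines_eq) (simp, erule v'(2))
  then show "meet_lines (span (w ` J)) v ({1..d} - I) (span (v ` I)) \<in> line_decomps (span (w ` J))"
    using basis_family_line_decomps[OF v'(1)] by simp
  have "lower_term d v w I J = apt v I \<otimes> apt w' ({1..d} - J)"
    by (rule lower_term_apt[OF fin(1)]) (erule w'(2))
  then show "lower_term d v w I J \<in> St2 (span (v ` I))"
    using tensor_apt_St2[OF basis_family_subset[OF v IJ(1)] w'(1)] by simp
  have "upper_term d v w I J = apt v' ({1..d} - I) \<otimes> apt w J"
    by (rule upper_term_apt[OF fin(2)]) (erule v'(2))
  then show "upper_term d v w I J \<in> St2 (span (w ` J))"
    using tensor_apt_St2[OF v'(1) basis_family_subset[OF w IJ(2)]] by simp
qed

end

theorem proposition21: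
  fixes scale :: "'f::field \<Rightarrow> 'v::ab_group_add \<Rightarrow> 'v"
    and V :: "'v set" and d :: nat and v w :: "nat \<Rightarrow> 'v"
    and A B :: "'v set list \<Rightarrow>\<^sub>0 rat"
    and A_sub B_sub :: "nat set \<Rightarrow> 'v set"
    and lower upper :: "nat set \<Rightarrow> nat set \<Rightarrow> ('v set list \<times> 'v set list \<Rightarrow>\<^sub>0 rat)"
    and pairs :: "(nat set \<times> nat set) set"
  assumes "vector_space scale"
    and "module.subspace scale V"
    and "vector_space.dim scale V = d"
    and "steinberg.is_basis_list scale V (map v [1..<Suc d])"
    and "steinberg.is_basis_list scale V (map w [1..<Suc d])"
    and "A = steinberg.vec_apartment scale (map v [1..<Suc d])"
    and "B = steinberg.vec_apartment scale (map w [1..<Suc d])"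
    and "A_sub = steinberg.sub_span scale v"
    and "B_sub = steinberg.sub_span scale w"
    and "lower = steinberg.lower_term scale d v w"
    and "upper = steinberg.upper_term scale d v w"
    and "pairs = {(I, J). I \<subseteq> {1..d} \<and> J \<subseteq> {1..d} \<and>
      steinberg.direct_decomp scale V (A_sub I) (B_sub J)}"
  shows "A \<otimes> B \<in> steinberg.St2 scale V \<and>
    (\<forall>(I, J)\<in>pairs.
      steinberg.meet_lines scale (A_sub I) w ({1..d} - J) (B_sub J)
        \<in> steinberg.line_decomps scale (A_sub I) \<and>
      steinberg.meet_lines scale (B_sub J) v ({1..d} - I) (A_sub I)
        \<in> steinberg.line_decomps scale (B_sub J) \<and>
      lower I J \<in> steinberg.St2 scale (A_sub I) \<and>
      upper I J \<in> steinberg.St2 scale (B_sub J)) \<and>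
    steinberg.coproduct scale V (A \<otimes> B) \<in> steinberg.St2_sum scale V \<and>
    steinberg.coproduct scale V (A \<otimes> B) =
      (\<Sum>(I, J)\<in>pairs.
        fscale (of_int (sign (shuffle_perm d I ({1..d} - I)))
              * of_int (sign (shuffle_perm d ({1..d} - J) J)))
          (in_summand (A_sub I, B_sub J) (lower I J \<otimes> upper I J)))"
proof -
  interpret steinberg scale using assms(1) by (rule steinberg.intro)
  have "{1..d} = {1..<Suc d}" by auto
  then have K: "set [1..<Suc d] = {1..d}" "sorted_list_of_set {1..d} = [1..<Suc d]"
    by (simp_all only: set_upt sorted_list_of_set_range)
  have v: "basis_family v {1..d} V" and w: "basis_family w {1..d} V"
    using basis_family_is_basis_list[OF assms(4)] basis_family_is_basis_list[OF assms(5)]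
    unfolding K .
  have AB: "A = apt v {1..d}" "B = apt w {1..d}"
    unfolding assms(6,7) K(2)[symmetric] by (rule vec_apartment_apt, simp)+
  have subs: "A_sub = (\<lambda>I. span (v ` I))" "B_sub = (\<lambda>J. span (w ` J))"
    unfolding assms(8,9) sub_span_def by (rule refl)+
  have pairs: "pairs = {(I, J). I \<subseteq> {1..d} \<and> J \<subseteq> {1..d} \<and> direct_decomp V (span (v ` I)) (span (w ` J))}"
    using assms(12) unfolding subs .
  have coproduct: "coproduct V (A \<otimes> B) = (\<Sum>(I, J)\<in>pairs.
      fscale (of_int (cross_sgn I ({1..d} - I)) * of_int (cross_sgn ({1..d} - J) J))
        (in_summand (span (v ` I), span (w ` J)) (lower I J \<otimes> upper I J)))"
    unfolding AB pairs assms(10,11)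
  proof (rule coproduct_apt[OF v w])
    fix I J w' assume "I \<subseteq> {1..d}"
      and w': "\<And>T. T \<subseteq> {1..d} - J \<Longrightarrow> span (v ` I) \<inter> span (w ` (T \<union> J)) = span (w' ` T)"
    then have "finite I" by (auto intro: finite_subset)
    then show "lower_term d v w I J = apt v I \<otimes> apt w' ({1..d} - J)"
      by (rule lower_term_apt) (erule w')
  next
    fix I J v' assume "J \<subseteq> {1..d}"
      and v': "\<And>T. T \<subseteq> {1..d} - I \<Longrightarrow> span (w ` J) \<inter> span (v ` (T \<union> I)) = span (v' ` T)"
    then have "finite J" by (auto intro: finite_subset)
    then show "upper_term d v w I J = apt v' ({1..d} - I) \<otimes> apt w J"
      by (rule upper_term_apt) (erule v')
  qed
  \<comment> \<open>Read off the explicit formula: each term is a multiple of a generator of the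
    direct sum.\<close>
  have "coproduct V (A \<otimes> B) \<in> St2_sum V"
    unfolding coproduct St2_sum_def
  proof (intro free.span_sum)
    fix q assume q: "q \<in> pairs"
    obtain I J where IJ: "q = (I, J)" by (cases q)
    then have "I \<subseteq> {1..d}" "J \<subseteq> {1..d}" and dd: "direct_decomp V (span (v ` I)) (span (w ` J))"
      using q pairs by auto
    note props = meet_lines_term_props(3,4)[OF v w this(1,2) dd, folded assms(10,11)]
    show "(case q of (I, J) \<Rightarrow>
        fscale (of_int (cross_sgn I ({1..d} - I)) * of_int (cross_sgn ({1..d} - J) J))
          (in_summand (span (v ` I), span (w ` J)) (lower I J \<otimes> upper I J)))
      \<in> free.span {in_summand (U1, U2) (x \<otimes> y) | U1 U2 x y.
          direct_decomp V U1 U2 \<and> x \<in> St2 U1 \<and> y \<in> St2 U2}"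
      unfolding IJ prod.case using dd props by (intro free.span_scale free.span_base) blast
  qed
  moreover have "coproduct V (A \<otimes> B) = (\<Sum>(I, J)\<in>pairs.
      fscale (of_int (sign (shuffle_perm d I ({1..d} - I))) * of_int (sign (shuffle_perm d ({1..d} - J) J)))
        (in_summand (A_sub I, B_sub J) (lower I J \<otimes> upper I J)))"
    unfolding coproduct subs
  proof (intro sum.cong refl, clarify)
    fix I J assume "(I, J) \<in> pairs"
    then have "I \<subseteq> {1..d}" "J \<subseteq> {1..d}" using pairs by auto
    \<comment> \<open>In tau_J the complement of J is the first block, so J has to be presented as
      the complement of that block.\<close>
    then have "J = {1..d} - ({1..d} - J)" by blast
    show "fscale (of_int (cross_sgn I ({1..d} - I)) * of_int (cross_sgn ({1..d} - J) J))
        (in_summand (span (v ` I), span (w ` J)) (lower I J \<otimes> upper I J)) =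
      fscale (of_int (sign (shuffle_perm d I ({1..d} - I))) * of_int (sign (shuffle_perm d ({1..d} - J) J)))
        (in_summand (span (v ` I), span (w ` J)) (lower I J \<otimes> upper I J))"
      using sign_shuffle_perm[OF \<open>I \<subseteq> {1..d}\<close> refl]
        sign_shuffle_perm[OF Diff_subset \<open>J = _\<close>] by simp
  qed
  moreover have "A \<otimes> B \<in> St2 V" unfolding AB by (rule tensor_apt_St2[OF v w])
  moreover have "\<forall>(I, J)\<in>pairs.
      meet_lines (A_sub I) w ({1..d} - J) (B_sub J) \<in> line_decomps (A_sub I) \<and>
      meet_lines (B_sub J) v ({1..d} - I) (A_sub I) \<in> line_decomps (B_sub J) \<and>
      lower I J \<in> St2 (A_sub I) \<and> upper I J \<in> St2 (B_sub J)"
    unfolding subs assms(10,11)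
  proof
    fix q assume q: "q \<in> pairs"
    obtain I J where IJ: "q = (I, J)" by (cases q)
    then have "I \<subseteq> {1..d}" "J \<subseteq> {1..d}" "direct_decomp V (span (v ` I)) (span (w ` J))"
      using q pairs by auto
    then show "case q of (I, J) \<Rightarrow>
        meet_lines (span (v ` I)) w ({1..d} - J) (span (w ` J)) \<in> line_decomps (span (v ` I)) \<and>
        meet_lines (span (w ` J)) v ({1..d} - I) (span (v ` I)) \<in> line_decomps (span (w ` J)) \<and>
        lower_term d v w I J \<in> St2 (span (v ` I)) \<and> upper_term d v w I J \<in> St2 (span (w ` J))"
      unfolding IJ prod.case by (intro conjI meet_lines_term_props[OF v w])
  qed
  ultimately show ?thesis by (intro conjI)
qed

end
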